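(* Let $f$ be a transcendental entire function in the Eremenko–Lyubich class $\mathcal{B}$. If $f$ has a finite logarithmic asymptotic value, then $I(f)$ is not a spider's web.
   Context: $f^n$ denotes the $n$-th iterate of $f$; $I(f) := \{z\in\mathbb{C} : f^n(z)\to\infty\}$ is the escaping set. The class $\mathcal{B}$ consists of transcendental entire functions whose set of singular values (critical values and asymptotic values, i.e. points at which some inverse branch cannot be defined) is bounded. Write $B(a,r)=\{z:|z-a|<r\}$. A value $\alpha\in\mathbb{C}$ is a finite logarithmic asymptotic value of $f$ if there exist $r>0$ and a component $U$ of $f^{-1}(B(\alpha,r))$ such that $f:U\to B(\alpha,r)\setminus\{\alpha\}$ is a universal covering. A connected set $E\subset\mathbb{C}$ is a spider's web if there is a sequence $(G_n)_{n\in\mathbb{N}}$ of bounded simply connected domains with $\partial G_n\subset E$, $G_n\subset G_{n+1}$ for all $n$, and $\bigcup_n G_n=\mathbb{C}$. *)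

theory Defs
  imports "HOL-Complex_Analysis.Complex_Analysis" "HOL-Computational_Algebra.Polynomial"
begin

definition transcendental_entire :: "(complex \<Rightarrow> complex) \<Rightarrow> bool" where
  "transcendental_entire f \<longleftrightarrow> f holomorphic_on UNIV \<and> \<not> (\<exists>p. \<forall>z. f z = poly p z)"

definition critical_values :: "(complex \<Rightarrow> complex) \<Rightarrow> complex set" where
  "critical_values f = {f z | z. deriv f z = 0}"

definition asymptotic_values :: "(complex \<Rightarrow> complex) \<Rightarrow> complex set" where
  "asymptotic_values f = {a. \<exists>\<gamma> :: real \<Rightarrow> complex.
      continuous_on {0..} \<gamma> \<and> filterlim \<gamma> at_infinity at_top \<and>
      ((\<lambda>t. f (\<gamma> t)) \<longlongrightarrow> a) at_top}"

definition singular_values :: "(complex \<Rightarrow> complex) \<Rightarrow> complex set" where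
  "singular_values f = closure (critical_values f \<union> asymptotic_values f)"

definition class_B :: "(complex \<Rightarrow> complex) \<Rightarrow> bool" where
  "class_B f \<longleftrightarrow> transcendental_entire f \<and> bounded (singular_values f)"

definition escaping_set :: "(complex \<Rightarrow> complex) \<Rightarrow> complex set" where
  "escaping_set f = {z. filterlim (\<lambda>n. (f ^^ n) z) at_infinity sequentially}"

definition finite_log_asymptotic_value :: "(complex \<Rightarrow> complex) \<Rightarrow> complex \<Rightarrow> bool" where
  "finite_log_asymptotic_value f \<alpha> \<longleftrightarrow>
     (\<exists>r>0. \<exists>U. U \<in> components (f -` ball \<alpha> r) \<and>
        covering_space U f (ball \<alpha> r - {\<alpha>}) \<and> simply_connected U)"

definition spiders_web :: "complex set \<Rightarrow> bool" where
  "spiders_web E \<longleftrightarrow> connected E \<and>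
     (\<exists>G :: nat \<Rightarrow> complex set.
        (\<forall>n. open (G n) \<and> connected (G n) \<and> G n \<noteq> {} \<and> bounded (G n) \<and>
             simply_connected (G n) \<and> frontier (G n) \<subseteq> E \<and> G n \<subseteq> G (Suc n)) \<and>
        (\<Union>n. G n) = UNIV)"

end

theory Submission
  imports Defs
begin

text \<open>
  Let \<open>U\<close> be a logarithmic tract over \<open>\<alpha>\<close> and let \<open>G\<close> be a bounded domain with frontier in the escaping
  set that contains a large enough part of \<open>U\<close>. Every path from near \<open>\<alpha>\<close> to the circle of radius \<open>\<epsilon>\<close>
  about \<open>\<alpha>\<close> lifts to a path in \<open>U\<close> that crosses the frontier of \<open>G\<close>, so the image of the part of this
  frontier lying in \<open>U\<close> surrounds \<open>\<alpha>\<close>. Some iterate of the surrounded neighbourhood of \<open>\<alpha>\<close> again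
  contains such a large part of \<open>U\<close>: by Schottky's theorem the only obstruction is uniform escape near
  \<open>\<alpha>\<close>, which is impossible by the expansion estimate of Eremenko and Lyubich. Repeating this yields
  nested compact subsets of the frontier of \<open>G\<close> that return to the disc about \<open>\<alpha>\<close> at infinitely many
  times, hence a point of this frontier that does not escape.
\<close>

section \<open>Lifting discs through an entire function\<close>

lemma holomorphic_funpow:
  assumes "f holomorphic_on UNIV"
  shows "(f ^^ n) holomorphic_on UNIV"
proof (induction n)
  case 0
  then show ?case by (simp add: id_def)
next
  case (Suc n)
  then show ?case
    using holomorphic_on_compose_gen [OF Suc.IH assms] by (simp add: o_def)
qed

text \<open>Bloch's theorem applied to a logarithm \<open>L\<close> of \<open>h\<close> puts a disc
  of radius more than pi into the image of \<open>L\<close>. Its vertical diameter is longer than 2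
  pi, so \<open>exp\<close> covers a full circle. Read contrapositively, this bounds the logarithmic
  derivative of a zero-free map covering no circle about 0.\<close>

lemma image_contains_circle:
  fixes h :: "complex \<Rightarrow> complex"
  assumes holh: "h holomorphic_on ball a s" and "0 < s"
    and nz: "\<And>z. z \<in> ball a s \<Longrightarrow> h z \<noteq> 0"
    and big: "12 * pi * norm (h a) < s * norm (deriv h a)"
  obtains t where "0 < t" "sphere 0 t \<subseteq> h ` ball a s"
proof -
  obtain L where holL: "L holomorphic_on ball a s" and L: "\<And>z. z \<in> ball a s \<Longrightarrow> h z = exp (L z)"
    using contractible_imp_holomorphic_log [OF holh convex_imp_contractible [OF convex_ball] nz]
    by blast
  have a: "a \<in> ball a s"
    using \<open>0 < s\<close> by simp
  have dL: "(L has_field_derivative deriv L a) (at a)"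
    using holL a by (simp add: holomorphic_derivI)
  have "((\<lambda>z. exp (L z)) has_field_derivative exp (L a) * deriv L a) (at a)"
    by (rule DERIV_fun_exp [OF dL])
  then have "(h has_field_derivative exp (L a) * deriv L a) (at a)"
    by (rule has_field_derivative_transform_within_open [of _ _ _ "ball a s"]) (use a L in auto)
  then have "deriv h a = h a * deriv L a"
    using DERIV_imp_deriv L [OF a] by simp
  with big have "norm (h a) * (12 * pi) < norm (h a) * (s * norm (deriv L a))"
    by (simp add: norm_mult algebra_simps)
  then have large: "pi < s * norm (deriv L a) / 12"
    using nz [OF a] by (simp add: mult_less_cancel_left)
  obtain b where b: "ball b (s * norm (deriv L a) / 12) \<subseteq> L ` ball a s"
    using Bloch [OF holL \<open>0 < s\<close> order_refl] by blast
  have "sphere 0 (exp (Re b)) \<subseteq> h ` ball a s"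
  proof
    fix z :: complex assume "z \<in> sphere 0 (exp (Re b))"
    then have z: "norm z = exp (Re b)" by simp
    then have "z \<noteq> 0" by auto
    \<comment> \<open>\<open>z / exp b\<close> has modulus 1, so \<open>w\<close> is imaginary of
      modulus at most pi and \<open>b + w\<close> stays in the Bloch disc.\<close>
    define w where "w = Ln (z / exp b)"
    have nz': "z / exp b \<noteq> 0"
      using \<open>z \<noteq> 0\<close> by simp
    have "norm (z / exp b) = 1"
      using z by (simp add: norm_divide)
    then have "Re w = 0"
      using Re_Ln [OF nz'] by (simp add: w_def)
    moreover have "\<bar>Im w\<bar> \<le> pi"
      using Im_Ln_le_pi [OF nz'] mpi_less_Im_Ln [OF nz'] by (simp add: w_def)
    ultimately have "norm w \<le> pi"
      using cmod_le [of w] by simp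
    then have "b + w \<in> ball b (s * norm (deriv L a) / 12)"
      using large by (simp add: dist_norm)
    then obtain x where x: "x \<in> ball a s" "L x = b + w"
      using b by (metis (no_types, lifting) imageE subsetD)
    have "h x = exp b * exp w"
      using x L by (simp add: exp_add)
    also have "\<dots> = z"
      using exp_Ln [OF nz'] by (simp add: w_def)
    finally show "z \<in> h ` ball a s"
      using x by blast
  qed
  then show thesis
    using that by (metis exp_gt_zero)
qed

text \<open>The lift is a local inverse of \<open>f\<close> composed with \<open>g\<close>.
  Injectivity of \<open>f\<close> on \<open>ball z e\<close> is recorded because it later forces two
  lifts with values in that ball to agree.\<close>

lemma local_lift:
  fixes f g :: "complex \<Rightarrow> complex"
  assumes holf: "f holomorphic_on UNIV" and d: "deriv f z \<noteq> 0"
    and holg: "g holomorphic_on S" and S: "open S" "w \<in> S" and eq: "f z = g w"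
  obtains \<delta> e \<psi> where "0 < \<delta>" "0 < e" "inj_on f (ball z e)" "ball w \<delta> \<subseteq> S"
    "\<psi> holomorphic_on ball w \<delta>" "\<psi> ` ball w \<delta> \<subseteq> ball z e"
    "\<psi> w = z" "\<And>v. v \<in> ball w \<delta> \<Longrightarrow> f (\<psi> v) = g v"
proof -
  obtain e where e: "0 < e" "open (f ` ball z e)" "inj_on f (ball z e)"
    using has_complex_derivative_locally_invertible [OF holf UNIV_I open_UNIV d] by blast
  obtain k where k: "k holomorphic_on f ` ball z e" "\<And>x. x \<in> ball z e \<Longrightarrow> k (f x) = x"
    using holomorphic_has_inverse [OF holomorphic_on_subset [OF holf subset_UNIV] open_ball e(3)] by metis
  have "open (S \<inter> g -` (f ` ball z e))"
    using continuous_open_preimage [OF holomorphic_on_imp_continuous_on [OF holg] S(1) e(2)] .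
  moreover have "w \<in> S \<inter> g -` (f ` ball z e)"
  proof -
    have "z \<in> ball z e" using e(1) by simp
    then have "g w \<in> f ` ball z e" unfolding eq [symmetric] by (rule imageI)
    then show ?thesis using S by simp
  qed
  ultimately obtain \<delta> where \<delta>: "0 < \<delta>" "ball w \<delta> \<subseteq> S \<inter> g -` (f ` ball z e)"
    using open_contains_ball by metis
  show thesis
  proof (rule that [of \<delta> e "k \<circ> g"])
    show "(k \<circ> g) holomorphic_on ball w \<delta>"
      by (rule holomorphic_on_compose_gen [OF holomorphic_on_subset [OF holg] k(1)]) (use \<delta> in auto)
    show "(k \<circ> g) ` ball w \<delta> \<subseteq> ball z e"
    proof clarify
      fix v assume "v \<in> ball w \<delta>"
      then obtain x where "x \<in> ball z e" "g v = f x" using \<delta>(2) by blast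
      then show "(k \<circ> g) v \<in> ball z e" using k(2) by simp
    qed
    show "f ((k \<circ> g) v) = g v" if "v \<in> ball w \<delta>" for v
    proof -
      obtain x where "x \<in> ball z e" "g v = f x" using \<delta>(2) \<open>v \<in> ball w \<delta>\<close> by blast
      then show ?thesis using k(2) by simp
    qed
    show "(k \<circ> g) w = z"
      using k(2) [of z] e(1) eq by simp
  qed (use e \<delta> in auto)
qed

text \<open>A lift along a radius accumulates at a finite point, because otherwise its image would end at
  an asymptotic value; a local inverse of \<^term>\<open>f\<close> at that point then continues the lift.\<close>

lemma lift_continuation_at_boundary:
  fixes f g \<phi> :: "complex \<Rightarrow> complex"
  assumes holf: "f holomorphic_on UNIV" and holg: "g holomorphic_on ball c \<rho>"
    and reg: "\<And>w. w \<in> ball c \<rho> \<Longrightarrow> g w \<notin> critical_values f \<union> asymptotic_values f"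
    and t: "0 < t" "t < \<rho>"
    and hol\<phi>: "\<phi> holomorphic_on ball c t" and \<phi>: "\<And>w. w \<in> ball c t \<Longrightarrow> f (\<phi> w) = g w"
    and \<zeta>: "\<zeta> \<in> sphere c t"
  obtains \<delta> \<psi> where "0 < \<delta>" "ball \<zeta> \<delta> \<subseteq> ball c \<rho>" "\<psi> holomorphic_on ball \<zeta> \<delta>"
    "\<And>v. v \<in> ball \<zeta> \<delta> \<Longrightarrow> f (\<psi> v) = g v"
    "\<And>v. v \<in> ball \<zeta> \<delta> \<inter> ball c t \<Longrightarrow> \<psi> v = \<phi> v"
proof -
  have \<zeta>\<rho>: "\<zeta> \<in> ball c \<rho>"
    using \<zeta> t by auto
  \<comment> \<open>The radius from \<open>c\<close> to \<open>\<zeta>\<close> is parametrised by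
    the half-line through u / (1 + u), because asymptotic values are defined by curves on
    \<open>{0..}\<close>.\<close>
  define r where "r u = c + of_real (u / (1 + u)) * (\<zeta> - c)" for u :: real
  have norm\<zeta>: "norm (\<zeta> - c) = t"
    using \<zeta> by (simp add: dist_norm norm_minus_commute)
  have r_in: "r u \<in> ball c t" if "0 \<le> u" for u
  proof -
    have "dist c (r u) = u / (1 + u) * t"
      using that norm\<zeta> by (simp add: r_def dist_norm norm_mult norm_divide del: of_real_divide)
    also have "\<dots> < 1 * t"
      using that t by (intro mult_strict_right_mono) (auto simp: field_simps)
    finally show ?thesis by simp
  qed
  have contr: "continuous_on {0..} r"
    unfolding r_def by (intro continuous_intros) auto
  have "((\<lambda>u::real. u / (1 + u)) \<longlongrightarrow> 1) at_top"
    by real_asymp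
  then have "(r \<longlongrightarrow> c + of_real 1 * (\<zeta> - c)) at_top"
    unfolding r_def by (intro tendsto_intros)
  then have rlim: "(r \<longlongrightarrow> \<zeta>) at_top" by simp
  have "isCont g \<zeta>"
    using holomorphic_on_imp_continuous_on [OF holg] \<zeta>\<rho>
    by (metis continuous_on_eq_continuous_at open_ball)
  then have glim: "((\<lambda>u. g (r u)) \<longlongrightarrow> g \<zeta>) at_top"
    using rlim isCont_tendsto_compose by blast
  have "\<forall>\<^sub>F u in at_top. g (r u) = f (\<phi> (r u))"
    using eventually_ge_at_top [of "0::real"] by eventually_elim (use r_in \<phi> in auto)
  then have flim: "((\<lambda>u. f (\<phi> (r u))) \<longlongrightarrow> g \<zeta>) at_top"
    using glim by (rule Lim_transform_eventually [rotated])
  have "continuous_on {0..} (\<lambda>u. \<phi> (r u))"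
    by (rule continuous_on_compose2 [OF holomorphic_on_imp_continuous_on [OF hol\<phi>] contr]) (use r_in in auto)
  moreover have "g \<zeta> \<notin> asymptotic_values f"
    using reg [OF \<zeta>\<rho>] by blast
  ultimately have "\<not> filterlim (\<lambda>u. \<phi> (r u)) at_infinity at_top"
    using flim unfolding asymptotic_values_def by blast
  then obtain M where M: "\<exists>\<^sub>F u in at_top. norm (\<phi> (r u)) < M"
    unfolding filterlim_at_infinity [OF order_refl] frequently_def
    by (auto simp: not_less)
  have "\<exists>u \<ge> real n. norm (\<phi> (r u)) < M" for n
    using M unfolding frequently_def eventually_at_top_linorder by blast
  then obtain x where x: "\<And>n. x n \<ge> real n" "\<And>n. norm (\<phi> (r (x n))) < M"
    by metis
  have xlim: "filterlim x at_top sequentially"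
    by (rule filterlim_at_top_mono [OF filterlim_real_sequentially]) (use x in auto)
  have "\<forall>n. \<phi> (r (x n)) \<in> cball 0 M"
    using x(2) by (auto simp: less_imp_le)
  then obtain z q where q: "strict_mono q" "((\<lambda>n. \<phi> (r (x n))) \<circ> q) \<longlonglongrightarrow> z"
    using compact_cball [of "0::complex" M, unfolded compact_def] by meson
  have xqlim: "filterlim (\<lambda>n. x (q n)) at_top sequentially"
    using filterlim_compose [OF xlim filterlim_subseq [OF q(1)]] by simp
  have "isCont f z"
    using holomorphic_on_imp_continuous_on [OF holf]
    by (metis UNIV_I continuous_on_eq_continuous_at open_UNIV)
  then have "(\<lambda>n. f (\<phi> (r (x (q n))))) \<longlonglongrightarrow> f z"
    using isCont_tendsto_compose q(2) by (fastforce simp: o_def)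
  moreover have "(\<lambda>n. f (\<phi> (r (x (q n))))) \<longlonglongrightarrow> g \<zeta>"
    by (rule filterlim_compose [OF flim xqlim])
  ultimately have fz: "f z = g \<zeta>"
    using LIMSEQ_unique by blast
  have "deriv f z \<noteq> 0"
    using reg [OF \<zeta>\<rho>] fz unfolding critical_values_def by force
  then obtain \<delta> e \<psi> where \<delta>: "0 < \<delta>" "0 < e" "inj_on f (ball z e)" "ball \<zeta> \<delta> \<subseteq> ball c \<rho>"
    "\<psi> holomorphic_on ball \<zeta> \<delta>" "\<psi> ` ball \<zeta> \<delta> \<subseteq> ball z e"
    "\<And>v. v \<in> ball \<zeta> \<delta> \<Longrightarrow> f (\<psi> v) = g v"
    using local_lift [OF holf _ holg open_ball \<zeta>\<rho> fz] by metis
  \<comment> \<open>A single point of the radius is sought that lies in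
    \<open>ball \<zeta> \<delta>\<close> and whose \<open>\<phi>\<close>-value lies in
    \<open>ball z e\<close>; near it both lifts take values where \<open>f\<close> is
    injective.\<close>
  have "\<forall>\<^sub>F n in sequentially. r (x (q n)) \<in> ball \<zeta> \<delta>"
    using filterlim_compose [OF rlim xqlim] \<delta>(1) topological_tendstoD [of _ \<zeta> _ "ball \<zeta> \<delta>"] by auto
  moreover have "\<forall>\<^sub>F n in sequentially. \<phi> (r (x (q n))) \<in> ball z e"
    using q(2) \<delta>(2) topological_tendstoD [of _ z _ "ball z e"] by (auto simp: o_def)
  ultimately have "\<forall>\<^sub>F n in sequentially. r (x (q n)) \<in> ball \<zeta> \<delta> \<and> \<phi> (r (x (q n))) \<in> ball z e"
    by eventually_elim auto
  then obtain n where n: "r (x (q n)) \<in> ball \<zeta> \<delta>" "\<phi> (r (x (q n))) \<in> ball z e"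
    by (auto simp: eventually_sequentially)
  have rc: "r (x (q n)) \<in> ball c t"
    using r_in x(1) [of "q n"] by simp
  define N where "N = ball \<zeta> \<delta> \<inter> (ball c t \<inter> \<phi> -` ball z e)"
  have "open N"
    unfolding N_def
    using continuous_open_preimage [OF holomorphic_on_imp_continuous_on [OF hol\<phi>] open_ball open_ball]
    by blast
  have "N \<noteq> {}"
    using n rc unfolding N_def by blast
  have eqN: "\<psi> v = \<phi> v" if "v \<in> N" for v
  proof (rule inj_onD [OF \<delta>(3)])
    show "f (\<psi> v) = f (\<phi> v)" using that \<delta>(7) \<phi> by (simp add: N_def)
    show "\<psi> v \<in> ball z e" using that \<delta>(6) unfolding N_def by blast
    show "\<phi> v \<in> ball z e" using that by (simp add: N_def)
  qed
  have "\<psi> v = \<phi> v" if "v \<in> ball \<zeta> \<delta> \<inter> ball c t" for v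
  proof (rule analytic_continuation_open [of N "ball \<zeta> \<delta> \<inter> ball c t" \<psi> \<phi>])
    show "connected (ball \<zeta> \<delta> \<inter> ball c t)"
      by (intro convex_connected convex_Int convex_ball)
    show "\<psi> holomorphic_on ball \<zeta> \<delta> \<inter> ball c t" "\<phi> holomorphic_on ball \<zeta> \<delta> \<inter> ball c t"
      using \<delta>(5) hol\<phi> holomorphic_on_subset by blast+
    show "N \<subseteq> ball \<zeta> \<delta> \<inter> ball c t" by (auto simp: N_def)
  qed (use \<open>open N\<close> \<open>N \<noteq> {}\<close> eqN that in auto)
  then show thesis
    using that \<delta> by blast
qed

text \<open>Near \<open>c\<close> both lifts take values in a disc on which \<open>f\<close> is
  injective, so they agree there; the identity theorem does the rest.\<close>

lemma lift_unique:
  fixes f \<phi> \<psi> :: "complex \<Rightarrow> complex"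
  assumes holf: "f holomorphic_on UNIV" and d: "deriv f (\<phi> c) \<noteq> 0" and "0 < t"
    and hol: "\<phi> holomorphic_on ball c t" "\<psi> holomorphic_on ball c t"
    and eq: "\<And>w. w \<in> ball c t \<Longrightarrow> f (\<phi> w) = f (\<psi> w)" and c: "\<phi> c = \<psi> c"
    and w: "w \<in> ball c t"
  shows "\<phi> w = \<psi> w"
proof -
  obtain e where e: "0 < e" "inj_on f (ball (\<phi> c) e)"
    using has_complex_derivative_locally_invertible [OF holf UNIV_I open_UNIV d] by blast
  define N where "N = (ball c t \<inter> \<phi> -` ball (\<phi> c) e) \<inter> (ball c t \<inter> \<psi> -` ball (\<phi> c) e)"
  have "open N"
    unfolding N_def
    by (intro open_Int continuous_open_preimage holomorphic_on_imp_continuous_on hol open_ball)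
  moreover have "N \<noteq> {}"
  proof -
    have "c \<in> N" using \<open>0 < t\<close> \<open>0 < e\<close> c by (simp add: N_def)
    then show ?thesis by blast
  qed
  moreover have "N \<subseteq> ball c t" by (auto simp: N_def)
  moreover have "\<phi> v = \<psi> v" if "v \<in> N" for v
    using inj_onD [OF e(2), of "\<phi> v" "\<psi> v"] that eq by (auto simp: N_def)
  ultimately show ?thesis
    using analytic_continuation_open [of N "ball c t" \<phi> \<psi>] hol w by auto
qed

section \<open>Continuation of lifts to growing concentric discs\<close>

text \<open>The local continuations at the points of the circle agree on overlaps and glue to a lift
  on an open neighbourhood of the closed disc, which by compactness contains a larger concentric
  disc.\<close>

lemma lift_extend:
  fixes f g \<phi> :: "complex \<Rightarrow> complex"
  assumes holf: "f holomorphic_on UNIV" and holg: "g holomorphic_on ball c \<rho>"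
    and reg: "\<And>w. w \<in> ball c \<rho> \<Longrightarrow> g w \<notin> critical_values f \<union> asymptotic_values f"
    and t: "0 < t" "t < \<rho>"
    and hol\<phi>: "\<phi> holomorphic_on ball c t" and \<phi>: "\<And>w. w \<in> ball c t \<Longrightarrow> f (\<phi> w) = g w"
  obtains t' \<phi>' where "t < t'" "t' \<le> \<rho>" "\<phi>' holomorphic_on ball c t'" "\<phi>' c = \<phi> c"
    "\<And>w. w \<in> ball c t' \<Longrightarrow> f (\<phi>' w) = g w"
proof -
  have "\<exists>\<delta> \<psi>. 0 < \<delta> \<and> ball \<zeta> \<delta> \<subseteq> ball c \<rho> \<and> \<psi> holomorphic_on ball \<zeta> \<delta> \<and>
    (\<forall>v \<in> ball \<zeta> \<delta>. f (\<psi> v) = g v) \<and> (\<forall>v \<in> ball \<zeta> \<delta> \<inter> ball c t. \<psi> v = \<phi> v)"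
    if "\<zeta> \<in> sphere c t" for \<zeta>
    by (rule lift_continuation_at_boundary [OF holf holg reg t hol\<phi> \<phi> that]) blast+
  then obtain \<delta> \<psi> where \<delta>: "\<And>\<zeta>. \<zeta> \<in> sphere c t \<Longrightarrow> 0 < \<delta> \<zeta> \<and> ball \<zeta> (\<delta> \<zeta>) \<subseteq> ball c \<rho> \<and>
      \<psi> \<zeta> holomorphic_on ball \<zeta> (\<delta> \<zeta>) \<and>
    (\<forall>v \<in> ball \<zeta> (\<delta> \<zeta>). f (\<psi> \<zeta> v) = g v) \<and> (\<forall>v \<in> ball \<zeta> (\<delta> \<zeta>) \<inter> ball c t. \<psi> \<zeta> v = \<phi> v)"
    by metis
  \<comment> \<open>Two overlapping discs centred on the circle overlap on the chord, hence inside \<^term>\<open>ball c t\<close>.\<close>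
  have agree: "\<psi> \<zeta> v = \<psi> \<xi> v" if "\<zeta> \<in> sphere c t" "\<xi> \<in> sphere c t" "v \<in> ball \<zeta> (\<delta> \<zeta>)" "v \<in> ball \<xi> (\<delta> \<xi>)"
    for \<zeta> \<xi> v
  proof (cases "\<zeta> = \<xi>")
    case False
    define S where "S = ball \<zeta> (\<delta> \<zeta>) \<inter> ball \<xi> (\<delta> \<xi>)"
    \<comment> \<open>\<open>x\<close> divides the chord in the ratio of the two radii, hence lies
      in both discs as soon as these overlap.\<close>
    define s where "s = \<delta> \<zeta> / (\<delta> \<zeta> + \<delta> \<xi>)"
    define x where "x = (1 - s) *\<^sub>R \<zeta> + s *\<^sub>R \<xi>"
    have pos: "0 < \<delta> \<zeta>" "0 < \<delta> \<xi>" using \<delta> that by auto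
    then have s: "0 < s" "s < 1" by (auto simp: s_def)
    have dd: "dist \<zeta> \<xi> < \<delta> \<zeta> + \<delta> \<xi>"
      using that dist_triangle2 [of \<zeta> \<xi> v] by (auto simp: dist_commute)
    have s1: "1 - s = \<delta> \<xi> / (\<delta> \<zeta> + \<delta> \<xi>)" using pos by (simp add: s_def field_simps)
    have "\<zeta> - x = s *\<^sub>R (\<zeta> - \<xi>)" "\<xi> - x = (1 - s) *\<^sub>R (\<xi> - \<zeta>)"
      by (simp_all add: x_def algebra_simps)
    then have dx: "dist \<zeta> x = s * dist \<zeta> \<xi>" "dist \<xi> x = (1 - s) * dist \<zeta> \<xi>"
      using s by (simp_all add: dist_norm norm_minus_commute)
    have "s * dist \<zeta> \<xi> < s * (\<delta> \<zeta> + \<delta> \<xi>)" "(1 - s) * dist \<zeta> \<xi> < (1 - s) * (\<delta> \<zeta> + \<delta> \<xi>)"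
      using dd s by (auto intro: mult_strict_left_mono)
    moreover have "s * (\<delta> \<zeta> + \<delta> \<xi>) = \<delta> \<zeta>" "(1 - s) * (\<delta> \<zeta> + \<delta> \<xi>) = \<delta> \<xi>"
      using pos unfolding s1 by (simp_all add: s_def)
    ultimately have "x \<in> S"
      using dx by (simp add: S_def)
    moreover have "x \<in> ball c t"
    proof -
      have "x \<in> open_segment \<zeta> \<xi>"
        using False s unfolding in_segment x_def by blast
      then have "dist x c < max (dist \<zeta> c) (dist \<xi> c)"
        by (smt (verit) dist_commute dist_decreases_open_segment)
      then show ?thesis using that by (simp add: dist_commute)
    qed
    ultimately have ne: "S \<inter> ball c t \<noteq> {}" by blast
    show ?thesis
    proof (rule analytic_continuation_open [of "S \<inter> ball c t" S "\<psi> \<zeta>" "\<psi> \<xi>"])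
      show "connected S" unfolding S_def by (intro convex_connected convex_Int convex_ball)
      show "\<psi> \<zeta> holomorphic_on S" "\<psi> \<xi> holomorphic_on S"
        using \<delta> [OF that(1)] \<delta> [OF that(2)] holomorphic_on_subset S_def by blast+
      show "\<psi> \<zeta> z = \<psi> \<xi> z" if "z \<in> S \<inter> ball c t" for z
        using \<delta> [OF \<open>\<zeta> \<in> sphere c t\<close>] \<delta> [OF \<open>\<xi> \<in> sphere c t\<close>] that by (simp add: S_def)
    qed (use ne that in \<open>auto simp: S_def\<close>)
  qed auto
  define D where "D = (\<Union>\<zeta> \<in> sphere c t. ball \<zeta> (\<delta> \<zeta>))"
  \<comment> \<open>The value does not depend on the centre picked by \<open>SOME\<close>, thanks to
    \<open>agree\<close>.\<close>
  define \<phi>' where "\<phi>' v = (if v \<in> ball c t then \<phi> v else \<psi> (SOME \<zeta>. \<zeta> \<in> sphere c t \<and> v \<in> ball \<zeta> (\<delta> \<zeta>)) v)" for v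
  have \<phi>'\<psi>: "\<phi>' v = \<psi> \<zeta> v" if "\<zeta> \<in> sphere c t" "v \<in> ball \<zeta> (\<delta> \<zeta>)" for \<zeta> v
  proof (cases "v \<in> ball c t")
    case True
    then show ?thesis using \<delta> [OF that(1)] that(2) by (simp add: \<phi>'_def)
  next
    case False
    let ?x = "SOME \<zeta>. \<zeta> \<in> sphere c t \<and> v \<in> ball \<zeta> (\<delta> \<zeta>)"
    have "?x \<in> sphere c t \<and> v \<in> ball ?x (\<delta> ?x)"
      by (rule someI) (use that in blast)
    then have "\<psi> ?x v = \<psi> \<zeta> v"
      using agree that by blast
    then show ?thesis using False by (simp add: \<phi>'_def)
  qed
  have hol: "\<phi>' holomorphic_on ball c t \<union> D"
  proof (rule holomorphic_on_Un)
    show "\<phi>' holomorphic_on ball c t"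
      by (rule holomorphic_transform [OF hol\<phi>]) (simp add: \<phi>'_def)
    show "\<phi>' holomorphic_on D"
      unfolding D_def
    proof (rule holomorphic_on_UN_open)
      show "\<phi>' holomorphic_on ball \<zeta> (\<delta> \<zeta>)" if "\<zeta> \<in> sphere c t" for \<zeta>
        by (rule holomorphic_transform [of "\<psi> \<zeta>"]) (use \<delta> \<phi>'\<psi> that in auto)
    qed auto
  qed (auto simp: D_def)
  have lift: "f (\<phi>' v) = g v" if "v \<in> ball c t \<union> D" for v
  proof (cases "v \<in> ball c t")
    case True
    then show ?thesis using \<phi> by (simp add: \<phi>'_def)
  next
    case False
    then obtain \<zeta> where "\<zeta> \<in> sphere c t" "v \<in> ball \<zeta> (\<delta> \<zeta>)"
      using \<open>v \<in> ball c t \<union> D\<close> unfolding D_def by blast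
    then show ?thesis using \<delta> \<phi>'\<psi> by simp
  qed
  have "cball c t \<subseteq> ball c t \<union> D"
  proof
    fix v assume "v \<in> cball c t"
    then consider "v \<in> ball c t" | "v \<in> sphere c t" by force
    then show "v \<in> ball c t \<union> D" by cases (use \<delta> in \<open>auto simp: D_def intro!: bexI [of _ v]\<close>)
  qed
  moreover have "open (ball c t \<union> D)" by (auto simp: D_def)
  ultimately have "\<exists>e>0. (\<Union>x \<in> cball c t. ball x e) \<subseteq> ball c t \<union> D"
    using compact_subset_open_imp_ball_epsilon_subset [OF compact_cball] by blast
  then obtain e where e: "0 < e" "(\<Union>x \<in> cball c t. ball x e) \<subseteq> ball c t \<union> D" by blast
  define t' where "t' = min \<rho> (t + e)"
  have sub: "ball c t' \<subseteq> ball c t \<union> D"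
  proof
    fix v assume v: "v \<in> ball c t'"
    show "v \<in> ball c t \<union> D"
    proof (cases "v \<in> ball c t")
      case False
      then have l: "t \<le> dist c v" "dist c v < t + e" using v by (auto simp: t'_def)
      \<comment> \<open>\<open>x\<close> is the radial projection of \<open>v\<close> to the circle
        of radius \<open>t\<close>; its distance from \<open>v\<close> is below
        \<open>e\<close>.\<close>
      define x where "x = c + of_real (t / dist c v) * (v - c)"
      have n0: "norm (v - c) = dist c v" "dist c v > 0"
        using order_less_le_trans [OF t(1) l(1)] by (simp_all add: dist_norm norm_minus_commute)
      have "x - c = of_real (t / dist c v) * (v - c)" by (simp add: x_def)
      then have "norm (x - c) = t" using n0 t by (simp add: norm_mult norm_divide)
      then have xt: "x \<in> cball c t" by (simp add: dist_norm norm_minus_commute)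
      have "v - x = of_real (1 - t / dist c v) * (v - c)" by (simp add: x_def algebra_simps)
      then have "dist x v = \<bar>1 - t / dist c v\<bar> * dist c v"
        using n0 by (simp add: dist_norm norm_minus_commute norm_mult del: of_real_diff of_real_divide)
      moreover have "0 \<le> 1 - t / dist c v" using l n0 by simp
      ultimately have "dist x v = dist c v - t" using n0 by (simp add: left_diff_distrib)
      then have "v \<in> ball x e" using l by simp
      then show ?thesis using e xt by blast
    qed auto
  qed
  show thesis
  proof (rule that [of t' \<phi>'])
    show "t < t'" "t' \<le> \<rho>" using e t by (auto simp: t'_def)
    show "\<phi>' holomorphic_on ball c t'" using hol sub holomorphic_on_subset by blast
    show "\<phi>' c = \<phi> c" using t by (simp add: \<phi>'_def)
    show "f (\<phi>' w) = g w" if "w \<in> ball c t'" for w using lift sub that by blast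
  qed
qed

text \<open>Continuity method: \<open>T\<close> is the supremum of the radii admitting a lift with
  value \<open>z\<close> at \<open>c\<close>. Uniqueness glues the lifts on smaller discs to one on
  \<open>ball c T\<close>, and \<open>lift_extend\<close> excludes
  \<open>T < \<rho>\<close>.\<close>

lemma lift_on_ball:
  fixes f g :: "complex \<Rightarrow> complex"
  assumes holf: "f holomorphic_on UNIV" and holg: "g holomorphic_on ball c \<rho>" and "0 < \<rho>"
    and reg: "\<And>w. w \<in> ball c \<rho> \<Longrightarrow> g w \<notin> critical_values f \<union> asymptotic_values f"
    and z: "f z = g c"
  obtains \<phi> where "\<phi> holomorphic_on ball c \<rho>" "\<phi> c = z" "\<And>w. w \<in> ball c \<rho> \<Longrightarrow> f (\<phi> w) = g w"
proof -
  define P where "P t \<phi> \<longleftrightarrow> \<phi> holomorphic_on ball c t \<and> \<phi> c = z \<and> (\<forall>w \<in> ball c t. f (\<phi> w) = g w)" for t \<phi>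
  define A where "A = {t. 0 < t \<and> t \<le> \<rho> \<and> (\<exists>\<phi>. P t \<phi>)}"
  have c: "c \<in> ball c \<rho>" using \<open>0 < \<rho>\<close> by simp
  have dz: "deriv f z \<noteq> 0"
    using reg [OF c] z unfolding critical_values_def by force
  obtain \<delta> \<psi> where \<delta>: "0 < \<delta>" "ball c \<delta> \<subseteq> ball c \<rho>" "P \<delta> \<psi>"
    using local_lift [OF holf dz holg open_ball c z] unfolding P_def by metis
  have "\<delta> \<in> A" using \<delta> by (auto simp: A_def ball_subset_ball_iff)
  have bdd: "bdd_above A" by (auto simp: A_def bdd_above_def)
  define T where "T = Sup A"
  have T: "0 < T" "T \<le> \<rho>"
  proof -
    show "0 < T" using cSup_upper [OF \<open>\<delta> \<in> A\<close> bdd] \<delta>(1) by (simp add: T_def)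
    show "T \<le> \<rho>" unfolding T_def by (rule cSup_least) (use \<open>\<delta> \<in> A\<close> in \<open>auto simp: A_def\<close>)
  qed
  have "\<exists>\<phi>. P s \<phi>" if "s < T" for s
  proof -
    obtain t where "t \<in> A" "s < t"
      using \<open>s < T\<close> less_cSupD [of A s] \<open>\<delta> \<in> A\<close> unfolding T_def by blast
    then obtain \<phi> where "P t \<phi>" by (auto simp: A_def)
    then have "P s \<phi>"
      unfolding P_def using \<open>s < t\<close> holomorphic_on_subset [OF _ subset_ball [of s t c]]
      by (auto simp: subset_ball)
    then show ?thesis by blast
  qed
  then obtain \<Phi> where \<Phi>: "\<And>s. s < T \<Longrightarrow> P s (\<Phi> s)" by metis
  \<comment> \<open>The radius is halfway between \<open>dist c w\<close> and \<open>T\<close>; by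
    \<open>\<phi>_eq\<close> any other radius between them gives the same value.\<close>
  define \<phi> where "\<phi> w = \<Phi> ((dist c w + T) / 2) w" for w
  have \<phi>_eq: "\<phi> w = \<Phi> s w" if "s < T" "w \<in> ball c s" for s w
  proof -
    define m where "m = min s ((dist c w + T) / 2)"
    have w: "w \<in> ball c m" "m > 0" "(dist c w + T) / 2 < T"
      using that by (auto simp: m_def) (smt (verit) zero_le_dist)+
    have sub: "ball c m \<subseteq> ball c s" "ball c m \<subseteq> ball c ((dist c w + T) / 2)"
      by (auto simp: m_def)
    note P1 = \<Phi> [OF that(1), unfolded P_def]
    note P2 = \<Phi> [OF w(3), unfolded P_def]
    show ?thesis
      unfolding \<phi>_def
    proof (rule lift_unique [where \<phi> = "\<Phi> ((dist c w + T) / 2)" and \<psi> = "\<Phi> s", OF holf _ w(2) _ _ _ _ w(1)])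
      show "\<Phi> ((dist c w + T) / 2) holomorphic_on ball c m" "\<Phi> s holomorphic_on ball c m"
        using P1 P2 sub holomorphic_on_subset by blast+
      show "f (\<Phi> ((dist c w + T) / 2) v) = f (\<Phi> s v)" if "v \<in> ball c m" for v
        using P1 P2 sub that by (metis subsetD)
    qed (use P1 P2 dz in auto)
  qed
  have PT: "P T \<phi>"
    unfolding P_def
  proof (intro conjI ballI)
    have "\<phi> holomorphic_on (\<Union>s \<in> {..<T}. ball c s)"
    proof (rule holomorphic_on_UN_open)
      show "\<phi> holomorphic_on ball c s" if "s \<in> {..<T}" for s
        by (rule holomorphic_transform [of "\<Phi> s"]) (use \<Phi> [of s] \<phi>_eq that in \<open>auto simp: P_def\<close>)
    qed auto
    moreover have "ball c T \<subseteq> (\<Union>s \<in> {..<T}. ball c s)"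
    proof
      fix w assume "w \<in> ball c T"
      then obtain s where "dist c w < s" "s < T" using dense by auto
      then show "w \<in> (\<Union>s \<in> {..<T}. ball c s)" by auto
    qed
    ultimately show "\<phi> holomorphic_on ball c T" using holomorphic_on_subset by blast
    show "\<phi> c = z" using \<Phi> [of "T/2"] T by (simp add: \<phi>_def P_def)
    show "f (\<phi> w) = g w" if "w \<in> ball c T" for w
    proof -
      obtain s where "dist c w < s" "s < T" using \<open>w \<in> ball c T\<close> dense by auto
      then show ?thesis using \<phi>_eq [of s w] \<Phi> [of s] by (simp add: P_def)
    qed
  qed
  have "T = \<rho>"
  proof (rule ccontr)
    assume "T \<noteq> \<rho>"
    then have "T < \<rho>" using T by simp
    then obtain t' \<phi>' where "T < t'" "t' \<le> \<rho>" "P t' \<phi>'"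
      using lift_extend [OF holf holg reg T(1), of \<phi>] PT unfolding P_def by metis
    then have "t' \<in> A" using T by (auto simp: A_def)
    then show False using cSup_upper [OF _ bdd] \<open>T < t'\<close> by (force simp: T_def)
  qed
  then show thesis using PT that unfolding P_def by blast
qed

section \<open>Expansion in the class B\<close>

text \<open>The expansion estimate of Eremenko and Lyubich. The lift of the exponential map through
  \<^term>\<open>f\<close> omits a point on each large circle, so Bloch's theorem bounds its logarithmic derivative.\<close>

lemma logarithmic_derivative_lower_bound:
  fixes f :: "complex \<Rightarrow> complex"
  assumes holf: "f holomorphic_on UNIV" and "0 < R" "0 \<le> \<rho>"
    and sing: "critical_values f \<union> asymptotic_values f \<subseteq> cball 0 R"
    and disc: "f ` cball 0 \<rho> \<subseteq> cball 0 R"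
    and U: "f ` U \<subseteq> cball 0 R" "\<And>t. \<rho> < t \<Longrightarrow> sphere 0 t \<inter> U \<noteq> {}"
    and z: "R < norm (f z)"
  shows "(ln (norm (f z)) - ln R) * norm (f z) \<le> 12 * pi * (norm z * norm (deriv f z))"
proof (rule ccontr)
  assume neg: "\<not> ?thesis"
  \<comment> \<open>\<open>s\<close> is the distance from \<open>Ln (f z)\<close> to the line
    \<open>Re w = ln R\<close>, so \<open>exp\<close> sends \<open>ball c s\<close> outside
    \<open>cball 0 R\<close>, where \<open>f\<close> has no critical or asymptotic value.\<close>
  define s where "s = ln (norm (f z)) - ln R"
  have "0 < s" using \<open>0 < R\<close> z unfolding s_def by (metis diff_gt_0_iff_gt ln_less_cancel_iff order_less_trans)
  have fz: "f z \<noteq> 0" using z \<open>0 < R\<close> by auto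
  define c where "c = Ln (f z)"
  have exp_large: "R < norm (exp w)" if "w \<in> ball c s" for w
  proof -
    have "\<bar>Re (c - w)\<bar> < s"
      using that abs_Re_le_cmod [of "c - w"] by (simp add: dist_norm)
    then have "ln R < Re w" using fz by (simp add: s_def c_def Re_Ln)
    then have "exp (ln R) < exp (Re w)" by simp
    then show ?thesis using \<open>0 < R\<close> by simp
  qed
  obtain \<phi> where \<phi>: "\<phi> holomorphic_on ball c s" "\<phi> c = z" "\<And>w. w \<in> ball c s \<Longrightarrow> f (\<phi> w) = exp w"
  proof (rule lift_on_ball [OF holf _ \<open>0 < s\<close>, of exp c z])
    show "exp w \<notin> critical_values f \<union> asymptotic_values f" if "w \<in> ball c s" for w
      using sing exp_large [OF that] by (auto simp: dist_norm)
    show "f z = exp c" using fz by (simp add: c_def)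
  qed (auto intro: holomorphic_intros)
  have away: "\<phi> w \<notin> cball 0 \<rho>" if "w \<in> ball c s" for w
    using disc exp_large [OF that] \<phi>(3) [OF that] by fastforce
  have c: "c \<in> ball c s" using \<open>0 < s\<close> by simp
  have "(f has_field_derivative deriv f z) (at (\<phi> c))"
    using holf \<phi>(2) by (simp add: holomorphic_derivI)
  moreover have "(\<phi> has_field_derivative deriv \<phi> c) (at c)"
    using \<phi>(1) c by (simp add: holomorphic_derivI)
  ultimately have "(f \<circ> \<phi> has_field_derivative deriv f z * deriv \<phi> c) (at c)"
    by (rule DERIV_chain)
  then have "(exp has_field_derivative deriv f z * deriv \<phi> c) (at c)"
    by (rule has_field_derivative_transform_within_open [of _ _ _ "ball c s"]) (use c \<phi>(3) in auto)
  then have "deriv f z * deriv \<phi> c = f z"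
    using DERIV_unique [OF DERIV_exp] fz by (metis c_def exp_Ln)
  then have prod: "norm (f z) = norm (deriv f z) * norm (deriv \<phi> c)"
    by (metis norm_mult)
  have "12 * pi * (norm z * norm (deriv f z)) < s * norm (f z)"
    using neg by (simp add: s_def)
  then have "norm (deriv f z) * (12 * pi * norm (\<phi> c)) < norm (deriv f z) * (s * norm (deriv \<phi> c))"
    by (simp add: prod \<phi>(2) mult_ac)
  then have big: "12 * pi * norm (\<phi> c) < s * norm (deriv \<phi> c)"
    by (simp add: mult_less_cancel_left)
  have "\<phi> w \<noteq> 0" if "w \<in> ball c s" for w
    using away [OF that] \<open>0 \<le> \<rho>\<close> by auto
  then obtain t where t: "0 < t" "sphere 0 t \<subseteq> \<phi> ` ball c s"
    using image_contains_circle [OF \<phi>(1) \<open>0 < s\<close> _ big] by blast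
  \<comment> \<open>The covered circle is larger than \<open>cball 0 \<rho>\<close>, which
    \<open>\<phi>\<close> avoids, so it meets \<open>U\<close>. There \<open>f\<close> is bounded by
    \<open>R\<close>, whereas \<open>f (\<phi> w) = exp w\<close> exceeds \<open>R\<close> in
    modulus.\<close>
  have "complex_of_real t \<in> sphere 0 t" using t(1) by simp
  then obtain x where "x \<in> ball c s" "\<phi> x = of_real t" using t(2) by (metis imageE subsetD)
  then have "\<rho> < t" using away [of x] t(1) by simp
  then obtain u where "u \<in> sphere 0 t" "u \<in> U" using U(2) by blast
  then obtain w where "w \<in> ball c s" "u = \<phi> w" using t by blast
  then show False
    using U(1) \<open>u \<in> U\<close> exp_large \<phi>(3) by fastforce
qed

text \<open>While orbits stay beyond \<open>M\<close>, each application of \<open>f\<close> at least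
  doubles the logarithmic derivative. Eventually \<open>image_contains_circle\<close> yields a
  circle inside an iterated image of the disc; the circle meets \<open>U\<close>, which
  \<open>f\<close> maps back below \<open>M\<close>.\<close>

lemma not_uniformly_escaping:
  fixes f :: "complex \<Rightarrow> complex"
  assumes holf: "f holomorphic_on UNIV" and "0 < R" "0 \<le> \<rho>"
    and sing: "critical_values f \<union> asymptotic_values f \<subseteq> cball 0 R"
    and disc: "f ` cball 0 \<rho> \<subseteq> cball 0 R"
    and U: "f ` U \<subseteq> cball 0 R" "\<And>t. \<rho> < t \<Longrightarrow> sphere 0 t \<inter> U \<noteq> {}"
    and M: "R * exp (24 * pi) \<le> M" "\<rho> \<le> M" and "0 < s"
    and esc: "\<And>n x. x \<in> ball y s \<Longrightarrow> M < norm ((f ^^ n) x)"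
  shows False
proof -
  have y: "y \<in> ball y s" using \<open>0 < s\<close> by simp
  have "R * 1 \<le> R * exp (24 * pi)" using \<open>0 < R\<close> by (intro mult_left_mono) auto
  then have "R \<le> M" using M by simp
  have hol: "(f ^^ n) holomorphic_on S" for n S
    using holomorphic_funpow [OF holf] holomorphic_on_subset by blast
  \<comment> \<open>The constant 24 pi in the bound on \<open>M\<close> is twice the 12 pi of the
    expansion estimate, which leaves the factor 2.\<close>
  have exp2: "2 * norm (f z) \<le> norm z * norm (deriv f z)" if "M < norm (f z)" for z
  proof -
    have "ln (R * exp (24 * pi)) \<le> ln (norm (f z))"
      using \<open>0 < R\<close> M that by (intro ln_mono) auto
    then have "24 * pi \<le> ln (norm (f z)) - ln R" using \<open>0 < R\<close> by (simp add: ln_mult)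
    then have "24 * pi * norm (f z) \<le> (ln (norm (f z)) - ln R) * norm (f z)"
      by (rule mult_right_mono) simp
    also have "\<dots> \<le> 12 * pi * (norm z * norm (deriv f z))"
      by (rule logarithmic_derivative_lower_bound [OF assms(1-7)]) (use that \<open>R \<le> M\<close> in auto)
    finally have "(12 * pi) * (2 * norm (f z)) \<le> (12 * pi) * (norm z * norm (deriv f z))"
      by simp
    then show ?thesis using mult_le_cancel_left_pos [of "12 * pi"] by simp
  qed
  have growth: "2 ^ n * norm ((f ^^ n) y) \<le> norm y * norm (deriv (f ^^ n) y)" for n
  proof (induction n)
    case 0
    then show ?case by (simp add: id_def)
  next
    case (Suc n)
    let ?z = "(f ^^ n) y"
    have "deriv (f ^^ Suc n) y = deriv f ?z * deriv (f ^^ n) y"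
    proof -
      have "f field_differentiable at ?z" "(f ^^ n) field_differentiable at y"
        using holf hol [of n UNIV] holomorphic_on_imp_differentiable_at by blast+
      then show ?thesis by (simp add: deriv_chain)
    qed
    then have D: "norm (deriv (f ^^ Suc n) y) = norm (deriv f ?z) * norm (deriv (f ^^ n) y)"
      by (simp only: norm_mult)
    have "2 ^ Suc n * norm ((f ^^ Suc n) y) = 2 ^ n * (2 * norm (f ?z))"
      by simp
    also have "\<dots> \<le> 2 ^ n * (norm ?z * norm (deriv f ?z))"
      using exp2 [of ?z] esc [OF y, of "Suc n"] by (intro mult_left_mono) auto
    also have "\<dots> = (2 ^ n * norm ?z) * norm (deriv f ?z)"
      by simp
    also have "\<dots> \<le> (norm y * norm (deriv (f ^^ n) y)) * norm (deriv f ?z)"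
      by (rule mult_right_mono [OF Suc.IH]) simp
    also have "\<dots> = norm y * norm (deriv (f ^^ Suc n) y)"
      unfolding D by simp
    finally show ?case .
  qed
  obtain n where n: "12 * pi * norm y / s < 2 ^ n"
    using real_arch_pow [of 2] by auto
  have "norm y > 0" using esc [OF y, of 0] \<open>R \<le> M\<close> \<open>0 < R\<close> by auto
  have "(f ^^ n) y \<noteq> 0" using esc [OF y, of n] \<open>R \<le> M\<close> \<open>0 < R\<close> by auto
  have "12 * pi * norm y < s * 2 ^ n"
    using n \<open>0 < s\<close> by (simp add: field_simps)
  then have "12 * pi * norm y * norm ((f ^^ n) y) < s * 2 ^ n * norm ((f ^^ n) y)"
    using \<open>(f ^^ n) y \<noteq> 0\<close> by (intro mult_strict_right_mono) auto
  also have "\<dots> \<le> s * (norm y * norm (deriv (f ^^ n) y))"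
    using growth [of n] \<open>0 < s\<close> by (simp add: mult.assoc mult_left_mono)
  finally have "norm y * (12 * pi * norm ((f ^^ n) y)) < norm y * (s * norm (deriv (f ^^ n) y))"
    by (simp add: mult_ac)
  then have big: "12 * pi * norm ((f ^^ n) y) < s * norm (deriv (f ^^ n) y)"
    using \<open>norm y > 0\<close> by (simp add: mult_less_cancel_left)
  have "(f ^^ n) x \<noteq> 0" if "x \<in> ball y s" for x
    using esc [OF that, of n] \<open>R \<le> M\<close> \<open>0 < R\<close> by auto
  then obtain t where t: "0 < t" "sphere 0 t \<subseteq> (f ^^ n) ` ball y s"
    using image_contains_circle [OF hol \<open>0 < s\<close> _ big] by blast
  have "complex_of_real t \<in> sphere 0 t" using t(1) by simp
  then obtain x where x: "x \<in> ball y s" "(f ^^ n) x = of_real t" using t(2) by (metis imageE subsetD)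
  then have "\<rho> < t" using esc [OF x(1), of n] M t by simp
  then obtain u where "u \<in> sphere 0 t" "u \<in> U" using U(2) by blast
  then obtain v where v: "v \<in> ball y s" "u = (f ^^ n) v" using t by blast
  then have "M < norm (f u)" using esc [OF v(1), of "Suc n"] by simp
  then show False using U(1) \<open>u \<in> U\<close> \<open>R \<le> M\<close> by fastforce
qed

section \<open>Normality and escaping points\<close>

text \<open>An affine change of variables moves the disc to the unit disc and the omitted values to
  0 and 1. The bound involves \<open>a\<close> and \<open>b\<close> only through \<open>d\<close>
  and \<open>M\<close>, so it is uniform when the omitted values vary with the iterate.\<close>

lemma Schottky_two_values:
  fixes h :: "complex \<Rightarrow> complex"
  assumes holh: "h holomorphic_on cball c s" and "0 < s"
    and omit: "\<And>z. z \<in> cball c s \<Longrightarrow> h z \<noteq> a \<and> h z \<noteq> b"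
    and d: "0 < d" "d \<le> dist a b" and M: "norm a \<le> M" "norm b \<le> M"
    and r: "norm (h c) \<le> r" and z: "z \<in> cball c (s/2)"
  shows "norm (h z) \<le> M + 2 * M * exp (pi * exp (pi * (14 + 2 * ((r + M) / d))))"
proof -
  define F where "F u = (h (c + of_real s * u) - a) / (b - a)" for u
  have ab: "b - a \<noteq> 0" using d by auto
  have dab: "d \<le> norm (b - a)" using d by (simp add: dist_norm norm_minus_commute)
  have sub: "c + of_real s * u \<in> cball c s" if "u \<in> cball 0 1" for u
    using that \<open>0 < s\<close> by (simp add: dist_norm norm_mult)
  have "h \<circ> (\<lambda>u. c + of_real s * u) holomorphic_on cball 0 1"
    by (rule holomorphic_on_compose_gen [OF _ holh]) (use sub in \<open>auto intro!: holomorphic_intros\<close>)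
  then have "(\<lambda>u. h (c + of_real s * u)) holomorphic_on cball 0 1"
    by (simp add: o_def)
  then have holF: "F holomorphic_on cball 0 1"
    unfolding F_def using ab by (intro holomorphic_intros) auto
  have F0: "norm (F 0) \<le> (r + M) / d"
  proof -
    have "norm (h c - a) \<le> r + M" using norm_triangle_ineq4 [of "h c" a] r M by linarith
    moreover have "0 \<le> r + M" using r M norm_ge_zero [of "h c"] norm_ge_zero [of a] by linarith
    ultimately show ?thesis
      unfolding F_def using dab d by (simp add: norm_divide frac_le)
  qed
  have F01: "\<not> (F u = 0 \<or> F u = 1)" if "u \<in> cball 0 1" for u
    using omit [OF sub [OF that]] ab by (auto simp: F_def)
  define u where "u = (z - c) / of_real s"
  have u: "norm u \<le> 1/2" using z \<open>0 < s\<close>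
    by (simp add: u_def norm_divide dist_norm norm_minus_commute field_simps)
  \<comment> \<open>Schottky's theorem at radius 1/2 contributes 12 (1/2) / (1 - 1/2) = 12, whence
    14 = 2 + 12 below.\<close>
  have "norm (F u) \<le> exp (pi * exp (pi * (2 + 2 * ((r + M) / d) + 12 * (1/2) / (1 - 1/2))))"
    by (rule Schottky [OF holF F0 F01 _ _ u]) auto
  then have Fu: "norm (F u) \<le> exp (pi * exp (pi * (14 + 2 * ((r + M) / d))))"
    by (simp add: algebra_simps)
  have "h z = a + (b - a) * F u"
    using ab \<open>0 < s\<close> by (simp add: F_def u_def)
  then have "norm (h z) \<le> norm a + norm (b - a) * norm (F u)"
    by (metis norm_mult norm_triangle_ineq)
  also have "\<dots> \<le> M + (2 * M) * exp (pi * exp (pi * (14 + 2 * ((r + M) / d))))"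
  proof (intro add_mono mult_mono Fu M)
    show "norm (b - a) \<le> 2 * M" using norm_triangle_ineq4 [of b a] M by linarith
    show "0 \<le> 2 * M" using M norm_ge_zero [of a] by linarith
  qed auto
  finally show ?thesis .
qed

section \<open>Open images, escape and frontiers under iteration\<close>

lemma open_image_funpow:
  assumes "f holomorphic_on UNIV" "\<not> f constant_on UNIV" "open S"
  shows "open ((f ^^ n) ` S)"
proof (induction n)
  case 0
  then show ?case using assms by simp
next
  case (Suc n)
  have "open (f ` (f ^^ n) ` S)"
    by (rule open_mapping_thm [OF assms(1) _ _ Suc.IH _ assms(2)]) auto
  then show ?case by (simp add: image_comp)
qed

lemma class_B_not_constant:
  assumes "class_B f"
  shows "\<not> f constant_on UNIV"
proof
  assume "f constant_on UNIV"
  then obtain c where "\<forall>z. f z = poly [:c:] z" by (auto simp: constant_on_def)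
  then show False using assms unfolding class_B_def transcendental_entire_def by blast
qed

lemma escaping_setD:
  assumes "z \<in> escaping_set f"
  shows "\<forall>\<^sub>F n in sequentially. M < norm ((f ^^ n) z)"
proof -
  \<comment> \<open>The 1 keeps the radius positive, as \<open>filterlim_at_infinity\<close>
    requires; \<open>M + 1\<close> makes the final inequality strict.\<close>
  have "\<forall>\<^sub>F n in sequentially. max 1 (M + 1) \<le> norm ((f ^^ n) z)"
    using assms unfolding escaping_set_def filterlim_at_infinity [OF order_refl]
    by (auto simp del: max.bounded_iff)
  then show ?thesis by eventually_elim simp
qed

lemma not_escapingD:
  assumes "z \<notin> escaping_set f"
  obtains M where "\<exists>\<^sub>F n in sequentially. norm ((f ^^ n) z) < M"
proof -
  obtain M where "0 < M" "\<not> (\<forall>\<^sub>F n in sequentially. M \<le> norm ((f ^^ n) z))"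
    using assms unfolding escaping_set_def filterlim_at_infinity [OF order_refl] by auto
  then show thesis
    using that by (simp add: not_eventually not_le)
qed

lemma escaping_set_image:
  assumes "z \<in> escaping_set f"
  shows "f z \<in> escaping_set f"
proof -
  have "filterlim (\<lambda>n. (f ^^ Suc n) z) at_infinity sequentially"
    by (rule filterlim_compose [OF _ filterlim_Suc]) (use assms in \<open>simp add: escaping_set_def\<close>)
  then show ?thesis
    unfolding escaping_set_def by (simp add: funpow_swap1)
qed

text \<open>The image of the compact closure is closed, so a frontier point of the image has a
  preimage in \<open>closure S\<close>; openness of the image keeps that preimage out of
  \<open>S\<close>.\<close>

lemma frontier_image_subset:
  fixes f :: "'a::heine_borel \<Rightarrow> 'b::t2_space"
  assumes "continuous_on (closure S) f" "bounded S" "open (f ` S)"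
  shows "frontier (f ` S) \<subseteq> f ` frontier S"
proof
  fix y assume y: "y \<in> frontier (f ` S)"
  have "closed (f ` closure S)"
    by (intro compact_imp_closed compact_continuous_image assms) (use assms in auto)
  then have "closure (f ` S) \<subseteq> f ` closure S"
    by (intro closure_minimal image_mono closure_subset)
  then obtain x where x: "x \<in> closure S" "y = f x"
    using y by (auto simp: frontier_def)
  moreover have "y \<notin> f ` S"
    using y assms(3) by (simp add: frontier_def interior_open)
  ultimately have "x \<in> frontier S"
    using interior_subset by (auto simp: frontier_def)
  then show "y \<in> f ` frontier S" using x by blast
qed

section \<open>Logarithmic tracts over a finite value\<close>

text \<open>Here \<^term>\<open>g\<close> is the lift through \<^term>\<open>f\<close> of the universal covering
  \<^term>\<open>\<lambda>w. \<alpha> + exp w\<close> of the punctured disc.\<close>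

locale logarithmic_tract =
  fixes f :: "complex \<Rightarrow> complex" and \<alpha> :: complex and r :: real
    and U :: "complex set" and g :: "complex \<Rightarrow> complex"
  assumes holf: "f holomorphic_on UNIV" and r_pos: "0 < r"
    and U_comp: "U \<in> components (f -` ball \<alpha> r)"
    and f_U: "f ` U \<subseteq> ball \<alpha> r - {\<alpha>}"
    and cont_g: "continuous_on {w. Re w < ln r} g"
    and g_in: "\<And>w. Re w < ln r \<Longrightarrow> g w \<in> U"
    and f_g: "\<And>w. Re w < ln r \<Longrightarrow> f (g w) = \<alpha> + exp w"
begin

section \<open>Level arcs and closed pieces of the tract\<close>

text \<open>One closed period of the vertical line: for 0 < \<open>\<epsilon>\<close> <
  \<open>r\<close> this is a compact piece of the tract that \<open>f\<close> maps onto the circle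
  of radius \<open>\<epsilon>\<close> about \<open>\<alpha>\<close>.\<close>

definition arc :: "real \<Rightarrow> complex set" where
  "arc \<epsilon> = g ` {w. Re w = ln \<epsilon> \<and> 0 \<le> Im w \<and> Im w \<le> 2 * pi}"

definition inner_tract :: "real \<Rightarrow> complex set" where
  "inner_tract \<epsilon> = U \<inter> f -` cball \<alpha> \<epsilon>"

lemma cont_f: "continuous_on S f"
  using holf holomorphic_on_imp_continuous_on holomorphic_on_subset by blast

lemma cont_funpow: "continuous_on S (f ^^ n)"
  using holomorphic_funpow [OF holf] holomorphic_on_imp_continuous_on holomorphic_on_subset by blast

lemma compact_arc:
  assumes "0 < \<epsilon>" "\<epsilon> < r"
  shows "compact (arc \<epsilon>)"
proof -
  have "{w. Re w = ln \<epsilon> \<and> 0 \<le> Im w \<and> Im w \<le> 2 * pi} = cbox (Complex (ln \<epsilon>) 0) (Complex (ln \<epsilon>) (2 * pi))"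
    by (auto simp: in_cbox_complex_iff)
  then have "compact {w. Re w = ln \<epsilon> \<and> 0 \<le> Im w \<and> Im w \<le> 2 * pi}" by simp
  moreover have "continuous_on {w. Re w = ln \<epsilon> \<and> 0 \<le> Im w \<and> Im w \<le> 2 * pi} g"
    by (rule continuous_on_subset [OF cont_g]) (use assms in auto)
  ultimately show ?thesis
    unfolding arc_def by (rule compact_continuous_image [rotated])
qed

lemma arc_nonempty: "arc \<epsilon> \<noteq> {}"
proof -
  have "Complex (ln \<epsilon>) 0 \<in> {w. Re w = ln \<epsilon> \<and> 0 \<le> Im w \<and> Im w \<le> 2 * pi}" by simp
  then show ?thesis unfolding arc_def by blast
qed

lemma dist_f_arc:
  assumes "0 < \<epsilon>" "\<epsilon> < r" "z \<in> arc \<epsilon>"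
  shows "dist \<alpha> (f z) = \<epsilon>"
  using assms f_g by (auto simp: arc_def dist_norm)

lemma arcs_disjoint:
  assumes "0 < \<epsilon>" "\<epsilon> < r" "0 < \<epsilon>'" "\<epsilon>' < r" "\<epsilon> \<noteq> \<epsilon>'"
  shows "arc \<epsilon> \<inter> arc \<epsilon>' = {}"
  using dist_f_arc assms by blast

lemma closed_inner_tract:
  assumes "\<epsilon> < r"
  shows "closed (inner_tract \<epsilon>)"
proof -
  obtain T where T: "closed T" "U = f -` ball \<alpha> r \<inter> T"
    using closedin_component [OF U_comp] by (auto simp: closedin_closed)
  have "x \<in> inner_tract \<epsilon> \<longleftrightarrow> x \<in> T \<inter> f -` cball \<alpha> \<epsilon>" for x
  proof -
    have "x \<in> U \<longleftrightarrow> dist \<alpha> (f x) < r \<and> x \<in> T"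
      using T(2) by (metis Int_iff mem_ball vimage_eq)
    then show ?thesis
      using assms by (auto simp: inner_tract_def)
  qed
  then have "inner_tract \<epsilon> = T \<inter> f -` cball \<alpha> \<epsilon>"
    by blast
  then show ?thesis
    using closed_Int [OF T(1) closed_vimage [OF closed_cball [of \<alpha> \<epsilon>] cont_f]] by metis
qed

text \<open>On a bounded part of the inner tract, compactness keeps \<open>f\<close> away from the
  omitted value \<open>\<alpha>\<close>, whereas \<open>f (g w)\<close> has distance
  \<open>exp (Re w)\<close> from \<open>\<alpha>\<close>. The bound is uniform in
  \<open>Im w\<close>.\<close>

lemma g_at_infinity:
  obtains N where "\<And>w. Re w < N \<Longrightarrow> Re w < ln r \<and> M < norm (g w)"
proof -
  define K where "K = inner_tract (r/2) \<inter> cball 0 M"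
  have "compact (f ` K)"
    unfolding K_def using closed_inner_tract [of "r/2"] r_pos
    by (intro compact_continuous_image cont_f closed_Int_compact) auto
  moreover have "\<alpha> \<notin> f ` K"
    using f_U by (auto simp: K_def inner_tract_def)
  ultimately obtain d where d: "0 < d" "\<And>y. y \<in> f ` K \<Longrightarrow> d \<le> dist \<alpha> y"
    using separate_point_closed compact_imp_closed by metis
  define N where "N = ln (min d (r/2))"
  show thesis
  proof (rule that [of N])
    fix w assume w: "Re w < N"
    have "exp (Re w) < exp N" using w by simp
    also have "exp N = min d (r/2)" using d r_pos by (simp add: N_def)
    finally have e: "exp (Re w) < d" "exp (Re w) < r/2" by auto
    then have "exp (Re w) < r" using r_pos by linarith
    then have wr: "Re w < ln r" using r_pos by (metis exp_less_cancel_iff exp_ln)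
    have "dist \<alpha> (f (g w)) = exp (Re w)"
      using f_g [OF wr] by (simp add: dist_norm)
    then have "g w \<notin> K" "g w \<in> inner_tract (r/2)"
      using d(2) [of "f (g w)"] e g_in [OF wr] by (force simp: inner_tract_def)+
    then show "Re w < ln r \<and> M < norm (g w)"
      using wr by (simp add: K_def)
  qed
qed

lemma U_meets_circle:
  assumes "u \<in> U" "norm u < t"
  shows "sphere 0 t \<inter> U \<noteq> {}"
proof -
  obtain N where N: "\<And>w. Re w < N \<Longrightarrow> Re w < ln r \<and> t < norm (g w)"
    using g_at_infinity by blast
  have "Re (of_real (N - 1)) < ln r \<and> t < norm (g (of_real (N - 1)))" by (rule N) simp
  then have "g (of_real (N - 1)) \<in> U - ball 0 t" using g_in by simp
  moreover have "connected U" using U_comp in_components_connected by blast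
  moreover have "0 < t" using assms(2) by (metis norm_ge_zero order_le_less_trans)
  ultimately have "U \<inter> frontier (ball 0 t) \<noteq> {}"
    using assms by (intro connected_Int_frontier) auto
  then show ?thesis using \<open>0 < t\<close> by (auto simp: frontier_ball)
qed

text \<open>The image under \<open>g\<close> of the half-plane to the left of \<open>w\<close> is
  connected, meets \<open>V\<close>, and leaves it far to the left. This later produces escaping
  points arbitrarily near \<open>\<alpha>\<close>.\<close>

lemma ray_meets_frontier:
  assumes "bounded V" "g w \<in> V" "Re w < ln r"
  obtains v where "Re v \<le> Re w" "g v \<in> frontier V"
proof -
  obtain M where M: "\<And>x. x \<in> V \<Longrightarrow> norm x \<le> M"
    using assms(1) by (auto simp: bounded_iff)
  obtain N where N: "\<And>w. Re w < N \<Longrightarrow> Re w < ln r \<and> M < norm (g w)"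
    using g_at_infinity by blast
  let ?H = "{v. Re v \<le> Re w}"
  have "connected ?H" by (simp add: convex_connected convex_halfspace_Re_le)
  moreover have "continuous_on ?H g"
    by (rule continuous_on_subset [OF cont_g]) (use assms in auto)
  ultimately have "connected (g ` ?H)" by (rule connected_continuous_image [rotated])
  moreover have "g ` ?H \<inter> V \<noteq> {}" using assms(2) by blast
  moreover have "g ` ?H - V \<noteq> {}"
  proof -
    let ?x = "complex_of_real (min (Re w) (N - 1))"
    have "M < norm (g ?x)" using N [of ?x] by simp
    then have "g ?x \<notin> V" using M by force
    moreover have "?x \<in> ?H" by simp
    ultimately show ?thesis by blast
  qed
  ultimately have "g ` ?H \<inter> frontier V \<noteq> {}" by (rule connected_Int_frontier)
  then show thesis using that by blast
qed

text \<open>A path leaving a small neighbourhood of \<^term>\<open>\<alpha>\<close> through the circle of radius \<^term>\<open>\<epsilon>\<close>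
  lifts to a path in the tract that ends on \<^term>\<open>arc \<epsilon>\<close> and starts far out, outside \<^term>\<open>V\<close>.\<close>

lemma image_frontier_surrounds:
  assumes \<epsilon>: "0 < \<epsilon>" "\<epsilon> < r" and V: "bounded V" "arc \<epsilon> \<subseteq> V"
  defines "Q \<equiv> f ` (frontier V \<inter> inner_tract \<epsilon>)"
  shows "compact Q" "\<alpha> \<notin> Q" "connected_component_set (- Q) \<alpha> \<subseteq> ball \<alpha> \<epsilon>"
proof -
  have "compact (frontier V)" using V(1) by (simp add: compact_frontier_bounded)
  then show Q: "compact Q"
    unfolding Q_def by (intro compact_continuous_image cont_f compact_Int_closed closed_inner_tract \<epsilon>)
  show \<alpha>Q: "\<alpha> \<notin> Q"
    using f_U by (auto simp: Q_def inner_tract_def)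
  let ?W = "connected_component_set (- Q) \<alpha>"
  have opW: "open ?W" using compact_imp_closed [OF Q] by (simp add: open_Compl open_connected_component)
  have \<alpha>W: "\<alpha> \<in> ?W" using \<alpha>Q by simp
  obtain M where M: "\<And>x. x \<in> V \<Longrightarrow> norm x \<le> M"
    using V(1) by (auto simp: bounded_iff)
  obtain N where N: "\<And>w. Re w < N \<Longrightarrow> Re w < ln r \<and> M < norm (g w)"
    using g_at_infinity by blast
  show "?W \<subseteq> ball \<alpha> \<epsilon>"
  proof (rule ccontr)
    assume "\<not> ?W \<subseteq> ball \<alpha> \<epsilon>"
    then obtain b where b: "b \<in> ?W" "b \<notin> ball \<alpha> \<epsilon>" by blast
    obtain e where e: "0 < e" "ball \<alpha> e \<subseteq> ?W" using opW \<alpha>W open_contains_ball by blast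
    \<comment> \<open>\<open>\<delta> < e\<close> keeps \<open>a\<close> in the component,
      \<open>\<delta> < \<epsilon>\<close> starts the path inside the disc, and
      \<open>\<delta> < exp N\<close> puts the corresponding end of the lift outside
      \<open>V\<close>.\<close>
    define \<delta> where "\<delta> = min (e/2) (min (\<epsilon>/2) (exp N / 2))"
    have \<delta>: "0 < \<delta>" "\<delta> < e" "\<delta> < \<epsilon>" "\<delta> < exp N"
    proof -
      have "0 < exp N" by simp
      then show "0 < \<delta>" "\<delta> < e" "\<delta> < \<epsilon>" "\<delta> < exp N" using e \<epsilon> unfolding \<delta>_def min_def by auto
    qed
    define a where "a = \<alpha> + of_real \<delta>"
    have a: "dist \<alpha> a = \<delta>" "a \<noteq> \<alpha>" "a \<in> ?W"
    proof -
      show "dist \<alpha> a = \<delta>" using \<delta>(1) by (simp add: a_def dist_norm)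
      then show "a \<in> ?W" using e(2) \<delta>(2) by (metis mem_ball subsetD)
      show "a \<noteq> \<alpha>" using \<delta>(1) by (simp add: a_def)
    qed
    have "b \<noteq> \<alpha>" using b(2) \<epsilon> by auto
    \<comment> \<open>The path must avoid \<open>\<alpha>\<close>, since \<open>exp\<close> omits 0
      and only the punctured disc lifts.\<close>
    have "path_connected (?W - {\<alpha>})"
      by (rule path_connected_open_delete [OF opW]) auto
    then obtain p where p: "path p" "path_image p \<subseteq> ?W - {\<alpha>}" "pathstart p = a" "pathfinish p = b"
      using a b \<open>b \<noteq> \<alpha>\<close> unfolding path_connected_def by blast
    obtain h where h: "path h" "pathstart h = a" "path_image h \<subseteq> path_image p"
      "path_image h - {pathfinish h} \<subseteq> interior (ball \<alpha> \<epsilon>)" "pathfinish h \<in> frontier (ball \<alpha> \<epsilon>)"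
    proof (rule exists_path_subpath_to_frontier [OF p(1), of "ball \<alpha> \<epsilon>"])
      show "pathstart p \<in> closure (ball \<alpha> \<epsilon>)" using p(3) a \<delta> \<epsilon> by simp
      show "pathfinish p \<notin> ball \<alpha> \<epsilon>" using p(4) b by simp
    qed (use p(3) in auto)
    have fin: "dist \<alpha> (pathfinish h) = \<epsilon>" using h(5) \<epsilon> by (simp add: frontier_ball)
    have im_h: "x \<in> ?W \<and> x \<noteq> \<alpha> \<and> dist \<alpha> x \<le> \<epsilon>" if "x \<in> path_image h" for x
    proof -
      have "dist \<alpha> x \<le> \<epsilon>"
      proof (cases "x = pathfinish h")
        case False
        then have "x \<in> ball \<alpha> \<epsilon>" using h(4) that interior_subset by blast
        then show ?thesis by simp
      qed (use fin in simp)
      then show ?thesis using h(3) p(2) that by blast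
    qed
    \<comment> \<open>The path is reversed so that its lift can be started at the prescribed point
      \<open>w0\<close> over the circle, with \<open>g w0\<close> on the arc.\<close>
    define q where "q = (\<lambda>t. reversepath h t - \<alpha>)"
    have "path q" unfolding q_def path_def
      by (intro continuous_intros) (use h(1) in \<open>simp flip: path_def\<close>)
    have q_im: "q t + \<alpha> \<in> path_image h" if "t \<in> {0..1}" for t
      using that by (auto simp: q_def reversepath_def path_image_def)
    define w0 where "w0 = Complex (ln \<epsilon>) (Arg2pi (pathfinish h - \<alpha>))"
    have "norm (pathfinish h - \<alpha>) = \<epsilon>" using fin by (simp add: dist_norm norm_minus_commute)
    then have "pathfinish h - \<alpha> = of_real \<epsilon> * exp (\<i> * of_real (Arg2pi (pathfinish h - \<alpha>)))"
      using Arg2pi_eq by metis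
    moreover have "w0 = of_real (ln \<epsilon>) + \<i> * of_real (Arg2pi (pathfinish h - \<alpha>))"
      by (simp add: w0_def Complex_eq)
    ultimately have w0: "exp w0 = pathfinish h - \<alpha>"
      using \<epsilon> by (simp only: exp_add exp_of_real exp_ln)
    have "g w0 \<in> arc \<epsilon>"
      unfolding arc_def w0_def using Arg2pi [of "pathfinish h - \<alpha>"] by (intro imageI) (auto simp: less_imp_le)
    obtain k where k: "path k" "pathstart k = w0" "\<And>t. t \<in> {0..1} \<Longrightarrow> exp (k t) = q t"
    proof (rule covering_space_lift_path_strong [OF covering_space_exp_punctured_plane UNIV_I \<open>path q\<close>])
      show "path_image q \<subseteq> - {0}"
        using im_h q_im unfolding path_image_def by fastforce
      show "pathstart q = exp w0"
        using w0 by (simp add: q_def pathstart_def pathfinish_def reversepath_def)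
    qed blast
    have Re_k: "Re (k t) \<le> ln \<epsilon>" if "t \<in> {0..1}" for t
    proof -
      have "exp (Re (k t)) = norm (q t)" using k(3) [OF that] by (metis norm_exp_eq_Re)
      also have "\<dots> = dist \<alpha> (q t + \<alpha>)" by (simp add: dist_norm)
      also have "\<dots> \<le> \<epsilon>" using im_h q_im [OF that] by blast
      finally show ?thesis using \<epsilon> by (simp add: ln_ge_iff)
    qed
    have "ln \<epsilon> < ln r" using \<epsilon> by simp
    then have Re_k': "Re (k t) < ln r" if "t \<in> {0..1}" for t
      using Re_k [OF that] by linarith
    have "connected (g ` path_image k)"
      by (intro connected_continuous_image connected_path_image k(1) continuous_on_subset [OF cont_g])
        (use Re_k' in \<open>auto simp: path_image_def\<close>)
    moreover have "g w0 \<in> g ` path_image k" using k(2) pathstart_in_path_image by blast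
    then have "g ` path_image k \<inter> V \<noteq> {}" using \<open>g w0 \<in> arc \<epsilon>\<close> V(2) by blast
    moreover have "g ` path_image k - V \<noteq> {}"
    proof -
      have "q 1 = a - \<alpha>" using h(2) by (simp add: q_def reversepath_def pathstart_def)
      then have "exp (Re (k 1)) = \<delta>"
        using k(3) [of 1] a(1) by (metis atLeastAtMost_iff dist_commute dist_norm norm_exp_eq_Re order_refl zero_le_one)
      then have "exp (Re (k 1)) < exp N" using \<delta> by simp
      then have "M < norm (g (k 1))" using N by simp
      then have "g (k 1) \<notin> V" using M by force
      moreover have "k 1 \<in> path_image k" by (simp add: path_image_def)
      ultimately show ?thesis by blast
    qed
    ultimately have "g ` path_image k \<inter> frontier V \<noteq> {}" by (rule connected_Int_frontier)
    then obtain t where t: "t \<in> {0..1}" "g (k t) \<in> frontier V" unfolding path_image_def by blast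
    \<comment> \<open>The crossing point lies on \<open>frontier V\<close> in the inner tract, so
      its image is in \<open>Q\<close>; but this image is on the path, which runs in the complement
      of \<open>Q\<close>.\<close>
    have "f (g (k t)) = q t + \<alpha>" using f_g [OF Re_k' [OF t(1)]] k(3) [OF t(1)] by simp
    moreover have "q t + \<alpha> \<in> ?W" "dist \<alpha> (q t + \<alpha>) \<le> \<epsilon>" using im_h q_im [OF t(1)] by blast+
    ultimately have "f (g (k t)) \<in> Q"
      unfolding Q_def inner_tract_def using t g_in [OF Re_k' [OF t(1)]] by (intro imageI) auto
    moreover have "f (g (k t)) \<notin> Q"
      using \<open>f (g (k t)) = q t + \<alpha>\<close> \<open>q t + \<alpha> \<in> ?W\<close> connected_component_subset by fastforce
    ultimately show False by blast
  qed
qed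

text \<open>Otherwise the iterates would omit two values staying in disjoint compact sets, so Schottky's
  theorem applies. If \<^term>\<open>\<alpha>\<close> does not escape, then no point near \<^term>\<open>\<alpha>\<close> does; if it escapes,
  a whole neighbourhood escapes uniformly, which the expansion estimate forbids.\<close>

lemma iterate_covers_arc:
  assumes B: "class_B f"
    and acc: "\<And>\<delta>. 0 < \<delta> \<Longrightarrow> ball \<alpha> \<delta> \<inter> escaping_set f \<noteq> {}"
    and \<epsilon>: "0 < \<epsilon>" "\<epsilon> < \<epsilon>'" "\<epsilon>' < r" and N: "open N" "\<alpha> \<in> N"
  obtains m where "arc \<epsilon> \<subseteq> (f ^^ m) ` N \<or> arc \<epsilon>' \<subseteq> (f ^^ m) ` N"
proof (rule ccontr)
  assume "\<not> thesis"
  with that have "\<forall>n. \<exists>a b. a \<in> arc \<epsilon> - (f ^^ n) ` N \<and> b \<in> arc \<epsilon>' - (f ^^ n) ` N" by blast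
  then obtain a b where a: "\<And>n. a n \<in> arc \<epsilon> - (f ^^ n) ` N" and b: "\<And>n. b n \<in> arc \<epsilon>' - (f ^^ n) ` N"
    by metis
  have cpt: "compact (arc \<epsilon>)" "compact (arc \<epsilon>')" using compact_arc \<epsilon> by auto
  moreover have "arc \<epsilon> \<inter> arc \<epsilon>' = {}" using arcs_disjoint \<epsilon> by auto
  ultimately obtain d where d: "0 < d" "\<And>x y. x \<in> arc \<epsilon> \<Longrightarrow> y \<in> arc \<epsilon>' \<Longrightarrow> d \<le> dist x y"
    using separate_compact_closed [of "arc \<epsilon>" "arc \<epsilon>'"] compact_imp_closed by metis
  have "bounded (arc \<epsilon> \<union> arc \<epsilon>')" using cpt compact_imp_bounded by auto
  then obtain M where M: "\<And>x. x \<in> arc \<epsilon> \<union> arc \<epsilon>' \<Longrightarrow> norm x \<le> M"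
    by (auto simp: bounded_iff)
  obtain e where e: "0 < e" "cball \<alpha> e \<subseteq> N" using N open_contains_cball by blast
  \<comment> \<open>Discs of radius \<open>s\<close> about points of
    \<open>cball \<alpha> (s/2)\<close> then stay in \<open>N\<close>, so Schottky's theorem can be
    centred at \<open>\<alpha>\<close> or at a nearby point.\<close>
  define s where "s = e / 2"
  have "0 < s" using e by (simp add: s_def)
  define \<Phi> where "\<Phi> t = M + 2 * M * exp (pi * exp (pi * (14 + 2 * ((t + M) / d))))" for t
  have Sch: "norm ((f ^^ n) z) \<le> \<Phi> t"
    if "c \<in> cball \<alpha> (s/2)" "norm ((f ^^ n) c) \<le> t" "z \<in> cball c (s/2)" for n c t z
  proof -
    have "cball c s \<subseteq> N"
    proof
      fix x assume "x \<in> cball c s"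
      then have "dist \<alpha> x \<le> e" using that(1) dist_triangle [of \<alpha> x c] e(1) by (simp add: s_def)
      then show "x \<in> N" using e(2) by auto
    qed
    moreover have "(f ^^ n) holomorphic_on cball c s"
      using holomorphic_funpow [OF holf] holomorphic_on_subset by blast
    ultimately show ?thesis
      unfolding \<Phi>_def
    proof (intro Schottky_two_values [of "f ^^ n" c s "a n" "b n" d M t z])
      show "(f ^^ n) x \<noteq> a n \<and> (f ^^ n) x \<noteq> b n" if "x \<in> cball c s" for x
        using a [of n] b [of n] \<open>cball c s \<subseteq> N\<close> that by (metis Diff_iff image_eqI subsetD)
      show "d \<le> dist (a n) (b n)" "norm (a n) \<le> M" "norm (b n) \<le> M"
        using a [of n] b [of n] d(2) M by auto
    qed (use d that \<open>0 < s\<close> in auto)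
  qed
  show False
  proof (cases "\<alpha> \<in> escaping_set f")
    case False
    then obtain t where t: "\<exists>\<^sub>F n in sequentially. norm ((f ^^ n) \<alpha>) < t"
      by (rule not_escapingD)
    \<comment> \<open>At some common time the orbit of \<open>\<alpha>\<close> is below
      \<open>t\<close> while that of \<open>z\<close> is beyond \<open>\<Phi> t\<close>, against the
      Schottky bound.\<close>
    obtain z where z: "z \<in> ball \<alpha> (s/2)" "z \<in> escaping_set f"
      using acc [of "s/2"] \<open>0 < s\<close> by auto
    have "\<exists>\<^sub>F n in sequentially. norm ((f ^^ n) \<alpha>) < t \<and> \<Phi> t < norm ((f ^^ n) z)"
      using frequently_eventually_conj [OF t escaping_setD [OF z(2), of "\<Phi> t"]] by (simp add: conj_commute)
    then obtain n where n: "norm ((f ^^ n) \<alpha>) < t" "\<Phi> t < norm ((f ^^ n) z)"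
      using frequently_ex by blast
    then show False
      using Sch [of \<alpha> n t z] z(1) \<open>0 < s\<close> by simp
  next
    case True
    obtain u where u: "u \<in> U" using U_comp in_components_nonempty by blast
    have "critical_values f \<union> asymptotic_values f \<subseteq> singular_values f"
      unfolding singular_values_def by (rule closure_subset)
    then have "bounded (critical_values f \<union> asymptotic_values f)"
      using B bounded_subset unfolding class_B_def by blast
    moreover have "bounded (f ` cball 0 (norm u))"
      by (intro compact_imp_bounded compact_continuous_image cont_f compact_cball)
    moreover have "bounded (f ` U)"
      by (rule bounded_subset [OF bounded_ball]) (use f_U in blast)
    ultimately have "bounded (critical_values f \<union> asymptotic_values f \<union> f ` cball 0 (norm u) \<union> f ` U)"
      by simp
    then obtain R where R: "0 < R" "\<And>x. x \<in> critical_values f \<union> asymptotic_values f \<union> f ` cball 0 (norm u) \<union> f ` U \<Longrightarrow> norm x \<le> R"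
      by (meson bounded_pos)
    define L where "L = max (R * exp (24 * pi)) (norm u)"
    obtain k where k: "\<And>n. k \<le> n \<Longrightarrow> \<Phi> L < norm ((f ^^ n) \<alpha>)"
      using escaping_setD [OF True] unfolding eventually_sequentially by blast
    \<comment> \<open>Schottky's theorem is centred at \<open>x\<close> here: a small value at
      \<open>x\<close> would bound the value at \<open>\<alpha>\<close> by
      \<open>\<Phi> L\<close>.\<close>
    have esc: "L < norm ((f ^^ n) x)" if "k \<le> n" "x \<in> ball \<alpha> (s/2)" for n x
    proof (rule ccontr)
      assume "\<not> ?thesis"
      then have "norm ((f ^^ n) \<alpha>) \<le> \<Phi> L"
        using Sch [of x n L \<alpha>] that(2) by (simp add: dist_commute)
      then show False using k [OF that(1)] by simp
    qed
    \<comment> \<open>The estimate \<open>esc\<close> starts only at time \<open>k\<close>. Passing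
      to a disc about the \<open>k\<close>-th iterate of \<open>\<alpha>\<close> makes it hold from
      time 0.\<close>
    have "open ((f ^^ k) ` ball \<alpha> (s/2))"
      using open_image_funpow [OF holf class_B_not_constant [OF B]] by blast
    moreover have "(f ^^ k) \<alpha> \<in> (f ^^ k) ` ball \<alpha> (s/2)" using \<open>0 < s\<close> by (intro imageI) simp
    ultimately obtain q where q: "0 < q" "ball ((f ^^ k) \<alpha>) q \<subseteq> (f ^^ k) ` ball \<alpha> (s/2)"
      using open_contains_ball by blast
    show False
    proof (rule not_uniformly_escaping [OF holf R(1) norm_ge_zero [of u] _ _ _ _ _ _ q(1)])
      show "critical_values f \<union> asymptotic_values f \<subseteq> cball 0 R" "f ` cball 0 (norm u) \<subseteq> cball 0 R"
        "f ` U \<subseteq> cball 0 R" using R(2) by auto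
      show "sphere 0 t \<inter> U \<noteq> {}" if "norm u < t" for t using U_meets_circle [OF u that] .
      show "R * exp (24 * pi) \<le> L" "norm u \<le> L" by (auto simp: L_def)
      show "L < norm ((f ^^ n) x)" if "x \<in> ball ((f ^^ k) \<alpha>) q" for n x
      proof -
        obtain v where v: "v \<in> ball \<alpha> (s/2)" "x = (f ^^ k) v"
          using q(2) \<open>x \<in> ball ((f ^^ k) \<alpha>) q\<close> by blast
        have "(f ^^ n) x = (f ^^ (n + k)) v" by (simp add: v(2) funpow_add)
        then show ?thesis using esc [of "n + k" v] v(1) by simp
      qed
    qed
  qed
qed

section \<open>Nested compact sets of returning points\<close>

text \<open>One inductive step. \<open>Q'\<close> keeps the points of \<open>Q\<close> that at time
  \<open>n\<close> lie on \<open>frontier V\<close> inside the tract, so they enter the disc at time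
  \<open>Suc n\<close>. Their image surrounds \<open>\<alpha>\<close>, and a further iterate of the
  surrounded domain is the next \<open>V'\<close>. The disjunction is inherited from the two omitted
  values in Schottky's theorem.\<close>

lemma frontier_refinement:
  assumes B: "class_B f"
    and acc: "\<And>\<delta>. 0 < \<delta> \<Longrightarrow> ball \<alpha> \<delta> \<inter> escaping_set f \<noteq> {}"
    and \<epsilon>: "0 < \<epsilon>" "\<epsilon> < r" and \<epsilon>\<^sub>1: "0 < \<epsilon>\<^sub>1" "\<epsilon>\<^sub>1 < \<epsilon>\<^sub>2" "\<epsilon>\<^sub>2 < r"
    and Q: "compact Q" and V: "bounded V" "arc \<epsilon> \<subseteq> V" "frontier V \<subseteq> (f ^^ n) ` Q"
  obtains Q' m V' where "compact Q'" "Q' \<subseteq> Q" "n < m" "bounded V'" "arc \<epsilon>\<^sub>1 \<subseteq> V' \<or> arc \<epsilon>\<^sub>2 \<subseteq> V'"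
    "frontier V' \<subseteq> (f ^^ m) ` Q'" "(f ^^ Suc n) ` Q' \<subseteq> cball \<alpha> r"
proof -
  define C where "C = frontier V \<inter> inner_tract \<epsilon>"
  define Q' where "Q' = Q \<inter> (f ^^ n) -` C"
  have "closed C"
    unfolding C_def by (intro closed_Int frontier_closed closed_inner_tract \<epsilon>)
  then have "compact Q'"
    unfolding Q'_def using closed_vimage [OF _ cont_funpow] by (intro compact_Int_closed Q)
  have imQ': "(f ^^ n) ` Q' = C"
    using V(3) unfolding Q'_def C_def by auto
  define W where "W = connected_component_set (- (f ` C)) \<alpha>"
  note surr = image_frontier_surrounds [OF \<epsilon> V(1,2), folded C_def]
  have "open W"
    unfolding W_def using compact_imp_closed [OF surr(1)] by (simp add: open_Compl open_connected_component)
  have "\<alpha> \<in> W" using surr(2) by (simp add: W_def)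
  have "bounded W" using surr(3) bounded_ball bounded_subset unfolding W_def by blast
  have "W \<in> components (- (f ` C))"
    unfolding W_def by (rule componentsI) (use surr(2) in simp)
  then have frW: "frontier W \<subseteq> f ` C"
    using frontier_of_components_closed_complement [OF compact_imp_closed [OF surr(1)]] by blast
  obtain m where m: "arc \<epsilon>\<^sub>1 \<subseteq> (f ^^ m) ` W \<or> arc \<epsilon>\<^sub>2 \<subseteq> (f ^^ m) ` W"
    using iterate_covers_arc [OF B acc \<epsilon>\<^sub>1 \<open>open W\<close> \<open>\<alpha> \<in> W\<close>] by blast
  have opV': "open ((f ^^ m) ` W)"
    using open_image_funpow [OF holf class_B_not_constant [OF B] \<open>open W\<close>] by blast
  show thesis
  \<comment> \<open>The time increases even if \<open>m\<close> is 0, because \<open>f\<close> is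
    applied once to \<open>C\<close> before the \<open>m\<close> iterations.\<close>
  proof (rule that [of Q' "m + Suc n" "(f ^^ m) ` W"])
    have "compact ((f ^^ m) ` closure W)"
      by (intro compact_continuous_image cont_funpow) (use \<open>bounded W\<close> in simp)
    then show "bounded ((f ^^ m) ` W)"
      using compact_imp_bounded bounded_subset closure_subset image_mono by metis
    have "frontier ((f ^^ m) ` W) \<subseteq> (f ^^ m) ` frontier W"
      by (rule frontier_image_subset [OF cont_funpow \<open>bounded W\<close> opV'])
    also have "\<dots> \<subseteq> (f ^^ m) ` f ` (f ^^ n) ` Q'"
      using frW imQ' by blast
    also have "\<dots> = (f ^^ (m + Suc n)) ` Q'"
      by (simp only: funpow_add funpow.simps image_comp o_assoc)
    finally show "frontier ((f ^^ m) ` W) \<subseteq> (f ^^ (m + Suc n)) ` Q'" .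
    have "f ` C \<subseteq> cball \<alpha> r" using \<epsilon> by (auto simp: C_def inner_tract_def)
    moreover have "(f ^^ Suc n) ` Q' = f ` C" by (simp only: funpow.simps imQ' flip: image_comp)
    ultimately show "(f ^^ Suc n) ` Q' \<subseteq> cball \<alpha> r" by simp
  qed (use \<open>compact Q'\<close> m in \<open>auto simp: Q'_def\<close>)
qed

text \<open>Dependent choice iterates \<open>frontier_refinement\<close>. A point common to the
  nested compact sets lies on \<open>frontier G\<close> and returns to the disc at each of the
  increasing times \<open>Suc (n k)\<close>.\<close>

lemma frontier_not_escaping:
  assumes B: "class_B f"
    and acc: "\<And>\<delta>. 0 < \<delta> \<Longrightarrow> ball \<alpha> \<delta> \<inter> escaping_set f \<noteq> {}"
    and G: "bounded G" "arc (r/2) \<subseteq> G"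
  shows "\<not> frontier G \<subseteq> escaping_set f"
proof
  assume esc: "frontier G \<subseteq> escaping_set f"
  define P where "P s \<longleftrightarrow> (case s of (Q, n, V) \<Rightarrow> compact Q \<and> bounded V \<and>
    (arc (r/2) \<subseteq> V \<or> arc (r/3) \<subseteq> V) \<and> frontier V \<subseteq> (f ^^ n) ` Q)" for s :: "complex set \<times> nat \<times> complex set"
  define S where "S s s' \<longleftrightarrow> fst s' \<subseteq> fst s \<and> fst (snd s) < fst (snd s') \<and>
    (f ^^ Suc (fst (snd s))) ` fst s' \<subseteq> cball \<alpha> r" for s s' :: "complex set \<times> nat \<times> complex set"
  have step: "\<exists>s'. P s' \<and> S s s'" if "P s" for s
  proof -
    obtain Q n V where s: "s = (Q, n, V)" by (metis prod_cases3)
    have PQ: "compact Q" "bounded V" "frontier V \<subseteq> (f ^^ n) ` Q"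
      using that by (auto simp: P_def s)
    obtain \<epsilon> where \<epsilon>: "0 < \<epsilon>" "\<epsilon> < r" "arc \<epsilon> \<subseteq> V"
    proof (cases "arc (r/2) \<subseteq> V")
      case True
      then show thesis using that [of "r/2"] r_pos by simp
    next
      case False
      then have "arc (r/3) \<subseteq> V" using \<open>P s\<close> by (auto simp: P_def s)
      then show thesis using that [of "r/3"] r_pos by simp
    qed
    obtain Q' m V' where "compact Q'" "Q' \<subseteq> Q" "n < m" "bounded V'" "arc (r/3) \<subseteq> V' \<or> arc (r/2) \<subseteq> V'"
      "frontier V' \<subseteq> (f ^^ m) ` Q'" "(f ^^ Suc n) ` Q' \<subseteq> cball \<alpha> r"
      by (rule frontier_refinement [where \<epsilon>\<^sub>1 = "r/3" and \<epsilon>\<^sub>2 = "r/2", OF B acc \<epsilon>(1,2) _ _ _ PQ(1,2) \<epsilon>(3) PQ(3)])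
        (use r_pos in auto)
    then show ?thesis
      by (intro exI [of _ "(Q', m, V')"]) (auto simp: P_def S_def s)
  qed
  have "P (frontier G, 0, G)"
    using G by (simp add: P_def compact_frontier_bounded)
  then obtain s where s0: "s 0 = (frontier G, 0, G)" and s: "\<And>k. P (s k)" "\<And>k. S (s k) (s (Suc k))"
  proof -
    have "\<exists>s. \<forall>k. (P (s k) \<and> (k = 0 \<longrightarrow> s k = (frontier G, 0, G))) \<and> S (s k) (s (Suc k))"
      by (rule dependent_nat_choice) (use \<open>P (frontier G, 0, G)\<close> step in auto)
    then show thesis using that by blast
  qed
  define Q where "Q k = fst (s k)" for k
  define n where "n k = fst (snd (s k))" for k
  have cptQ: "compact (Q k)" for k
    using s(1) [of k] by (auto simp: P_def Q_def split: prod.splits)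
  \<comment> \<open>\<open>V\<close> is bounded and contains an arc, so its frontier is nonempty,
    and that frontier is covered by an image of \<open>Q k\<close>.\<close>
  have neQ: "Q k \<noteq> {}" for k
  proof -
    obtain R j V where sk: "s k = (R, j, V)" by (metis prod_cases3)
    then have V: "bounded V" "arc (r/2) \<subseteq> V \<or> arc (r/3) \<subseteq> V" "frontier V \<subseteq> (f ^^ j) ` R"
      using s(1) [of k] by (auto simp: P_def)
    have "V \<noteq> {}" using V(2) arc_nonempty by blast
    moreover have "V \<noteq> UNIV" using V(1) not_bounded_UNIV by blast
    ultimately have "frontier V \<noteq> {}" using frontier_eq_empty by blast
    then show ?thesis using V(3) by (auto simp: Q_def sk)
  qed
  have decQ: "Q (Suc k) \<subseteq> Q k" and incn: "n k < n (Suc k)"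
    and ret: "(f ^^ Suc (n k)) ` Q (Suc k) \<subseteq> cball \<alpha> r" for k
    using s(2) [of k] by (auto simp: S_def Q_def n_def)
  have "decseq Q" using decQ by (simp add: decseq_Suc_iff)
  then have "\<Inter> (range Q) \<noteq> {}"
    by (intro compact_nest) (auto simp: cptQ neQ decseq_def)
  then obtain z where z: "\<And>k. z \<in> Q k" by blast
  have "z \<in> escaping_set f"
    using z [of 0] esc s0 by (auto simp: Q_def)
  then obtain k where k: "\<And>j. k \<le> j \<Longrightarrow> norm \<alpha> + r < norm ((f ^^ j) z)"
    using escaping_setD unfolding eventually_sequentially by blast
  have "strict_mono n" using incn by (simp add: strict_mono_Suc_iff)
  then have "k \<le> Suc (n k)" using strict_mono_imp_increasing le_SucI by blast
  then have "norm \<alpha> + r < norm ((f ^^ Suc (n k)) z)" by (rule k)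
  moreover have "(f ^^ Suc (n k)) z \<in> cball \<alpha> r" using ret z by blast
  then have "norm ((f ^^ Suc (n k)) z) \<le> norm \<alpha> + r"
    using norm_triangle_ineq2 [of "(f ^^ Suc (n k)) z" \<alpha>] by (simp add: dist_norm norm_minus_commute)
  ultimately show False by linarith
qed

end

section \<open>Lifting the punctured disc and exhausting the arc\<close>

theorem theorem1p4:
  fixes f :: "complex \<Rightarrow> complex" and \<alpha> :: complex
  assumes "class_B f"
    and "finite_log_asymptotic_value f \<alpha>"
  shows "\<not> spiders_web (escaping_set f)"
proof
  assume "spiders_web (escaping_set f)"
  then obtain G :: "nat \<Rightarrow> complex set" where G: "\<And>n. open (G n)" "\<And>n. bounded (G n)"
      "\<And>n. frontier (G n) \<subseteq> escaping_set f" "\<And>n. G n \<subseteq> G (Suc n)" "(\<Union>n. G n) = UNIV"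
    unfolding spiders_web_def by blast
  obtain r U where r: "0 < r" and U: "U \<in> components (f -` ball \<alpha> r)"
    and cov: "covering_space U f (ball \<alpha> r - {\<alpha>})"
    using assms(2) unfolding finite_log_asymptotic_value_def by blast
  \<comment> \<open>\<open>\<alpha> + exp w\<close> maps this half-plane into the punctured disc;
    being simply connected, the half-plane lifts through the covering \<open>f\<close>.\<close>
  let ?H = "{w. Re w < ln r}"
  have "convex ?H" by (rule convex_halfspace_Re_lt)
  moreover have "open ?H" by (rule open_halfspace_Re_lt)
  moreover have "(\<lambda>w. \<alpha> + exp w) \<in> ?H \<rightarrow> ball \<alpha> r - {\<alpha>}"
  proof
    fix w assume "w \<in> ?H"
    then have "exp (Re w) < exp (ln r)" by simp
    then show "\<alpha> + exp w \<in> ball \<alpha> r - {\<alpha>}" using r by (simp add: dist_norm)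
  qed
  moreover have "continuous_on ?H (\<lambda>w. \<alpha> + exp w)" by (intro continuous_intros)
  ultimately obtain g where g: "continuous_on ?H g" "g \<in> ?H \<rightarrow> U" "\<And>w. w \<in> ?H \<Longrightarrow> f (g w) = \<alpha> + exp w"
    using covering_space_lift [OF cov convex_imp_simply_connected open_imp_locally_path_connected] by blast
  interpret logarithmic_tract f \<alpha> r U g
  proof
    show "f holomorphic_on UNIV"
      using assms(1) by (simp add: class_B_def transcendental_entire_def)
    show "f ` U \<subseteq> ball \<alpha> r - {\<alpha>}"
      using covering_space_imp_surjective [OF cov] by blast
  qed (use r U g in auto)
  have incG: "G m \<subseteq> G n" if "m \<le> n" for m n
    using lift_Suc_mono_le [of G] G(4) that by blast
  \<comment> \<open>Far to the left in the half-plane, \<open>g\<close> crosses the frontier of some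
    \<open>G n\<close>. The crossing point escapes, hence so does its image under \<open>f\<close>,
    which is close to \<open>\<alpha>\<close>.\<close>
  have acc: "ball \<alpha> \<delta> \<inter> escaping_set f \<noteq> {}" if "0 < \<delta>" for \<delta>
  proof -
    define w where "w = complex_of_real (ln (min \<delta> r / 2))"
    have w: "exp (Re w) < \<delta>" "exp (Re w) < r" using that r by (auto simp: w_def)
    then have wr: "Re w < ln r" using r by (metis exp_less_cancel_iff exp_ln)
    obtain n where "g w \<in> G n" using G(5) by blast
    then obtain v where v: "Re v \<le> Re w" "g v \<in> frontier (G n)"
      using ray_meets_frontier [OF G(2) _ wr] by blast
    then have "f (g v) \<in> escaping_set f" using G(3) escaping_set_image by blast
    moreover have "f (g v) = \<alpha> + exp v" using v(1) wr f_g by simp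
    moreover have "exp (Re v) < \<delta>" using v(1) w(1) by (meson exp_le_cancel_iff order_le_less_trans)
    ultimately have "f (g v) \<in> ball \<alpha> \<delta> \<inter> escaping_set f" by (simp add: dist_norm)
    then show ?thesis by blast
  qed
  have "compact (arc (r/2))" using compact_arc r by simp
  then obtain n where "arc (r/2) \<subseteq> G n"
  proof (rule compactE_image [of _ UNIV G])
    fix C :: "nat set" assume C: "finite C" "arc (r/2) \<subseteq> (\<Union>c \<in> C. G c)"
    have "(\<Union>c \<in> C. G c) \<subseteq> G (Max C)" using incG C(1) by (meson Max_ge UN_least)
    then show thesis using that C(2) by blast
  qed (use G in auto)
  then show False
    using frontier_not_escaping [OF assms(1) acc G(2)] G(3) by blast
qed

end
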